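(* Let the snapshot space be $V=V^{no\_DQ}$ (difference quotients not included), and let $X^r=\mathrm{span}\{\varphi_1,\dots,\varphi_r\}$, $r\le d$, be the corresponding POD space. Let $u$ be the solution of the weak formulation of the heat equation, $u_r$ the solution of the POD Galerkin reduced order model, $P_r(u)$ the $L^2$ projection of $u$ onto $X^r$, $\eta^{L^2}:=u-P_r(u)$, $\phi_r:=u_r-P_r(u)$, and $C_{inv}(r):=\sqrt{\|S_r\|_2}$, where $S_r$ is the POD stiffness matrix. Then $$\frac12\,\frac{d}{dt}\|\phi_r\|\le C_{inv}(r)\,\nu\,\|\nabla\eta^{L^2}\| .$$
   Context: Let $\Omega$ be the computational domain and $X:=H_0^1(\Omega)$; $(\cdot,\cdot)$ and $\|\cdot\|$ denote the $L^2(\Omega)$ inner product and norm, and a subscript $t$ denotes the time derivative. Let $u(\cdot,t)\in X$, $t\in[0,T]$, be the weak solution of the heat equation with diffusion coefficient $\nu$ and forcing $f$: $(u_t,v)+\nu(\nabla u,\nabla v)=(f,v)$ for all $v\in X$. Snapshots and POD: given time instances $t_0,\dots,t_N\in[0,T]$, set $V^{no\_DQ}:=\mathrm{span}\{u(\cdot,t_0),\dots,u(\cdot,t_N)\}$. Write $s_1,\dots,s_M$, $M=N+1$, for these spanning functions and $d=\dim V^{no\_DQ}$. The POD basis $\{\varphi_1,\dots,\varphi_r\}$, $r\le d$, minimizes $\frac1M\sum_{i=1}^M\|s_i-\sum_{j=1}^r(s_i,\varphi_j)\varphi_j\|^2$ subject to $(\varphi_i,\varphi_j)=\delta_{ij}$,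 $1\le i,j\le r$. It is given by $\varphi_k=\lambda_k^{-1/2}\sum_{j=1}^M(v_k)_j s_j$, where $\lambda_1\ge\dots\ge\lambda_d>0$ are the positive eigenvalues and $v_1,\dots,v_d$ the associated eigenvectors of the snapshot correlation matrix $K\in\mathbb{R}^{M\times M}$, $K_{ij}=\frac1M(s_j,s_i)$. The POD stiffness matrix is $S_r\in\mathbb{R}^{r\times r}$ with entries $(S_r)_{ij}=(\nabla\varphi_j,\nabla\varphi_i)$, and $\|\cdot\|_2$ denotes the matrix 2-norm. Reduced order model: $u_r(\cdot,t)\in X^r$ satisfies $(u_{r,t},v_r)+\nu(\nabla u_r,\nabla v_r)=(f,v_r)$ for all $v_r\in X^r$. $L^2$ projection: $P_r(u)\in X^r$ is defined by $(u-P_r(u),v_r)=0$ for all $v_r\in X^r$. *)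

theory Defs
  imports "HOL-Analysis.Analysis" "Jordan_Normal_Form.Char_Poly"
begin

text \<open>
  Elements of Lebesgue and Sobolev spaces are represented by functions on the whole Euclidean
  space; only their values almost everywhere on \<open>\<Omega>\<close> matter. The inner product on \<open>'b\<close> is
  multiplication for \<open>'b = real\<close>, so the same notions serve functions and their gradients.
\<close>

definition L2 :: "'a::euclidean_space set \<Rightarrow> ('a \<Rightarrow> 'b::euclidean_space) set" where
  "L2 \<Omega> = {f. f \<in> borel_measurable (lebesgue_on \<Omega>) \<and>
              integrable (lebesgue_on \<Omega>) (\<lambda>x. (norm (f x))\<^sup>2)}"

definition l2_inner ::
    "'a::euclidean_space set \<Rightarrow> ('a \<Rightarrow> 'b::euclidean_space) \<Rightarrow> ('a \<Rightarrow> 'b) \<Rightarrow> real" where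
  "l2_inner \<Omega> f g = (LINT x|lebesgue_on \<Omega>. inner (f x) (g x))"

definition l2_norm :: "'a::euclidean_space set \<Rightarrow> ('a \<Rightarrow> 'b::euclidean_space) \<Rightarrow> real" where
  "l2_norm \<Omega> f = sqrt (l2_inner \<Omega> f f)"

text \<open>\<open>Ck n f\<close>: all iterated partial derivatives of \<open>f\<close> up to order \<open>n\<close> exist and are continuous.\<close>

fun Ck :: "nat \<Rightarrow> ('a::euclidean_space \<Rightarrow> real) \<Rightarrow> bool" where
  "Ck 0 f = continuous_on UNIV f"
| "Ck (Suc n) f = (f differentiable_on UNIV \<and>
     (\<forall>b\<in>Basis. Ck n (\<lambda>x. frechet_derivative f (at x) b)))"

definition test_functions :: "'a::euclidean_space set \<Rightarrow> ('a \<Rightarrow> real) set" where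
  "test_functions \<Omega> = {\<psi>. (\<forall>n. Ck n \<psi>) \<and> compact (closure {x. \<psi> x \<noteq> 0}) \<and>
                          closure {x. \<psi> x \<noteq> 0} \<subseteq> \<Omega>}"

definition gradient :: "('a::euclidean_space \<Rightarrow> real) \<Rightarrow> 'a \<Rightarrow> 'a" where
  "gradient \<psi> x = (\<Sum>b\<in>Basis. frechet_derivative \<psi> (at x) b *\<^sub>R b)"

definition is_weak_gradient ::
    "'a::euclidean_space set \<Rightarrow> ('a \<Rightarrow> real) \<Rightarrow> ('a \<Rightarrow> 'a) \<Rightarrow> bool" where
  "is_weak_gradient \<Omega> u g \<longleftrightarrow>
     (\<forall>\<psi>\<in>test_functions \<Omega>. \<forall>b\<in>Basis.
        (LINT x|lebesgue_on \<Omega>. u x * frechet_derivative \<psi> (at x) b) =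
        - (LINT x|lebesgue_on \<Omega>. inner (g x) b * \<psi> x))"

definition H1 :: "'a::euclidean_space set \<Rightarrow> ('a \<Rightarrow> real) set" where
  "H1 \<Omega> = {u \<in> L2 \<Omega>. \<exists>g\<in>L2 \<Omega>. is_weak_gradient \<Omega> u g}"

text \<open>For \<open>u \<in> H1 \<Omega>\<close> the weak gradient exists and is unique up to null sets.\<close>

definition weak_gradient :: "'a::euclidean_space set \<Rightarrow> ('a \<Rightarrow> real) \<Rightarrow> 'a \<Rightarrow> 'a" where
  "weak_gradient \<Omega> u = (SOME g. g \<in> L2 \<Omega> \<and> is_weak_gradient \<Omega> u g)"

text \<open>The closure of the test functions in the norm of \<open>H1 \<Omega>\<close>.\<close>

definition H10 :: "'a::euclidean_space set \<Rightarrow> ('a \<Rightarrow> real) set" where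
  "H10 \<Omega> = {u \<in> H1 \<Omega>. \<exists>\<psi>::nat \<Rightarrow> 'a \<Rightarrow> real. (\<forall>n. \<psi> n \<in> test_functions \<Omega>) \<and>
      (\<lambda>n. l2_norm \<Omega> (\<lambda>x. u x - \<psi> n x)) \<longlonglongrightarrow> 0 \<and>
      (\<lambda>n. l2_norm \<Omega> (\<lambda>x. weak_gradient \<Omega> u x - gradient (\<psi> n) x)) \<longlonglongrightarrow> 0}"

text \<open>
  \<open>w\<close> is an \<open>X\<close>-valued function on \<open>[0,T]\<close> with
  \<open>(w\<^sub>t, v) + \<nu> (\<nabla>w, \<nabla>v) = (f, v)\<close> for all \<open>v \<in> X\<close>, where \<open>(w\<^sub>t, v)\<close> is read as the derivative
  of \<open>(w, v)\<close> (one-sided at \<open>0\<close> and \<open>T\<close>). This covers an \<open>L2\<close>-valued derivative \<open>w\<^sub>t\<close> as well as one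
  with values in the dual of \<open>H10 \<Omega>\<close>. With \<open>X = H10 \<Omega>\<close> this is the weak heat equation, with
  \<open>X\<close> a POD space it is the Galerkin reduced order model.
\<close>

definition heat_solution_in ::
    "('a::euclidean_space \<Rightarrow> real) set \<Rightarrow> 'a set \<Rightarrow> real \<Rightarrow> real \<Rightarrow> (real \<Rightarrow> 'a \<Rightarrow> real)
     \<Rightarrow> (real \<Rightarrow> 'a \<Rightarrow> real) \<Rightarrow> bool" where
  "heat_solution_in X \<Omega> T \<nu> f w \<longleftrightarrow>
     (\<forall>t\<in>{0..T}. w t \<in> X \<and>
        (\<forall>v\<in>X. \<exists>D. ((\<lambda>s. l2_inner \<Omega> (w s) v) has_real_derivative D) (at t within {0..T}) \<and>
           D + \<nu> * l2_inner \<Omega> (weak_gradient \<Omega> (w t)) (weak_gradient \<Omega> v)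
             = l2_inner \<Omega> (f t) v))"

text \<open>Span and dimension in \<open>L2 \<Omega>\<close>, that is, modulo equality almost everywhere on \<open>\<Omega>\<close>.\<close>

definition L2_span ::
    "'a::euclidean_space set \<Rightarrow> nat \<Rightarrow> (nat \<Rightarrow> 'a \<Rightarrow> real) \<Rightarrow> ('a \<Rightarrow> real) set" where
  "L2_span \<Omega> n w = {g \<in> L2 \<Omega>. \<exists>c. AE x in lebesgue_on \<Omega>. g x = (\<Sum>k<n. c k * w k x)}"

definition L2_independent ::
    "'a::euclidean_space set \<Rightarrow> nat \<Rightarrow> (nat \<Rightarrow> 'a \<Rightarrow> real) \<Rightarrow> bool" where
  "L2_independent \<Omega> n w \<longleftrightarrow>
     (\<forall>c. (AE x in lebesgue_on \<Omega>. (\<Sum>k<n. c k * w k x) = 0) \<longrightarrow> (\<forall>k<n. c k = 0))"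

definition L2_dim :: "'a::euclidean_space set \<Rightarrow> ('a \<Rightarrow> real) set \<Rightarrow> nat" where
  "L2_dim \<Omega> V = (GREATEST n. \<exists>w. (\<forall>k<n. w k \<in> V) \<and> L2_independent \<Omega> n w)"

definition L2_orthonormal ::
    "'a::euclidean_space set \<Rightarrow> nat \<Rightarrow> (nat \<Rightarrow> 'a \<Rightarrow> real) \<Rightarrow> bool" where
  "L2_orthonormal \<Omega> r \<phi> \<longleftrightarrow> (\<forall>k<r. \<phi> k \<in> L2 \<Omega>) \<and>
     (\<forall>i<r. \<forall>j<r. l2_inner \<Omega> (\<phi> i) (\<phi> j) = (if i = j then 1 else 0))"

text \<open>Snapshots, eigenvalues, eigenvectors and POD modes are indexed from \<open>0\<close>.\<close>

definition POD_error ::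
    "'a::euclidean_space set \<Rightarrow> nat \<Rightarrow> (nat \<Rightarrow> 'a \<Rightarrow> real) \<Rightarrow> nat \<Rightarrow> (nat \<Rightarrow> 'a \<Rightarrow> real) \<Rightarrow> real" where
  "POD_error \<Omega> M s r \<phi> =
     1 / real M * (\<Sum>i<M. (l2_norm \<Omega> (\<lambda>x. s i x - (\<Sum>j<r. l2_inner \<Omega> (s i) (\<phi> j) * \<phi> j x)))\<^sup>2)"

definition is_POD_basis ::
    "'a::euclidean_space set \<Rightarrow> nat \<Rightarrow> (nat \<Rightarrow> 'a \<Rightarrow> real) \<Rightarrow> nat \<Rightarrow> (nat \<Rightarrow> 'a \<Rightarrow> real) \<Rightarrow> bool" where
  "is_POD_basis \<Omega> M s r \<phi> \<longleftrightarrow> L2_orthonormal \<Omega> r \<phi> \<and>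
     (\<forall>\<psi>. L2_orthonormal \<Omega> r \<psi> \<longrightarrow> POD_error \<Omega> M s r \<phi> \<le> POD_error \<Omega> M s r \<psi>)"

definition correlation_matrix ::
    "'a::euclidean_space set \<Rightarrow> nat \<Rightarrow> (nat \<Rightarrow> 'a \<Rightarrow> real) \<Rightarrow> real mat" where
  "correlation_matrix \<Omega> M s = mat M M (\<lambda>(i, j). 1 / real M * l2_inner \<Omega> (s j) (s i))"

text \<open>
  The first \<open>d\<close> entries of \<open>ev\<close> are positive eigenvalues of \<open>K\<close> in decreasing order, with mutually
  orthogonal eigenvectors; if \<open>d\<close> is the rank of the symmetric positive semidefinite matrix \<open>K\<close>,
  they are all its positive eigenvalues, with multiplicity. The lengths of the eigenvectors are
  left open, since they are determined by the normalization of the POD modes: with the factor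
  \<open>1/M\<close> in the correlation matrix, the modes below have norm \<open>1\<close> iff the eigenvectors have
  Euclidean length \<open>1/sqrt M\<close>.
\<close>

definition positive_eigensystem ::
    "real mat \<Rightarrow> nat \<Rightarrow> (nat \<Rightarrow> real) \<Rightarrow> (nat \<Rightarrow> real vec) \<Rightarrow> bool" where
  "positive_eigensystem K d ev v \<longleftrightarrow>
     (\<forall>k<d. ev k > 0 \<and> eigenvector K (v k) (ev k)) \<and>
     (\<forall>i j. i \<le> j \<and> j < d \<longrightarrow> ev j \<le> ev i) \<and>
     (\<forall>i<d. \<forall>j<d. i \<noteq> j \<longrightarrow> scalar_prod (v i) (v j) = 0)"

definition POD_mode ::
    "nat \<Rightarrow> (nat \<Rightarrow> 'a \<Rightarrow> real) \<Rightarrow> (nat \<Rightarrow> real) \<Rightarrow> (nat \<Rightarrow> real vec) \<Rightarrow> nat \<Rightarrow> 'a \<Rightarrow> real" where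
  "POD_mode M s ev v k x = ev k powr (- 1 / 2) * (\<Sum>j<M. vec_index (v k) j * s j x)"

definition stiffness_matrix ::
    "'a::euclidean_space set \<Rightarrow> nat \<Rightarrow> (nat \<Rightarrow> 'a \<Rightarrow> real) \<Rightarrow> real mat" where
  "stiffness_matrix \<Omega> r \<phi> =
     mat r r (\<lambda>(i, j). l2_inner \<Omega> (weak_gradient \<Omega> (\<phi> j)) (weak_gradient \<Omega> (\<phi> i)))"

definition vec_norm2 :: "real vec \<Rightarrow> real" where
  "vec_norm2 x = sqrt (scalar_prod x x)"

definition mat_norm2 :: "real mat \<Rightarrow> real" where
  "mat_norm2 A = (SUP x\<in>{x \<in> carrier_vec (dim_col A). vec_norm2 x \<le> 1}. vec_norm2 (A *\<^sub>v x))"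

definition C_inv :: "'a::euclidean_space set \<Rightarrow> nat \<Rightarrow> (nat \<Rightarrow> 'a \<Rightarrow> real) \<Rightarrow> real" where
  "C_inv \<Omega> r \<phi> = sqrt (mat_norm2 (stiffness_matrix \<Omega> r \<phi>))"

definition is_L2_projection ::
    "'a::euclidean_space set \<Rightarrow> ('a \<Rightarrow> real) set \<Rightarrow> ('a \<Rightarrow> real) \<Rightarrow> ('a \<Rightarrow> real) \<Rightarrow> bool" where
  "is_L2_projection \<Omega> Y w p \<longleftrightarrow> p \<in> Y \<and> (\<forall>v\<in>Y. l2_inner \<Omega> (\<lambda>x. w x - p x) v = 0)"

end

theory Submission
  imports Defs
begin

text \<open>
  Let \<open>\<alpha> k\<close> be the coordinates of \<open>\<phi>r\<close> in the orthonormal POD basis. Since \<open>\<eta>\<close> is orthogonal to the POD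
  space and the POD space lies in \<open>H10 \<Omega>\<close>, subtracting the two weak equations gives
  \<open>\<Sum>k. c k * \<alpha>' k = \<nu> (\<nabla>\<eta>, \<nabla>w) - \<nu> (\<nabla>\<phi>r, \<nabla>w)\<close> for \<open>w = \<Sum>k. c k * \<phi> k\<close>. The case \<open>c = \<alpha>\<close>, with the inverse estimate
  \<open>\<parallel>\<nabla>w\<parallel> \<le> C_inv * \<parallel>w\<parallel>\<close>, bounds the derivative wherever \<open>\<phi>r\<close> is not zero. At a zero of \<open>\<phi>r\<close> the absolute
  value of a one-sided derivative of \<open>\<parallel>\<phi>r\<parallel>\<close> is the Euclidean norm of \<open>\<alpha>'\<close>, which the case \<open>c = \<alpha>'\<close> bounds.
  Because weak gradients are arbitrary choices, their linearity up to null sets rests on the fundamental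
  lemma of the calculus of variations, for which the test functions are products of functions
  \<open>exp (- 1 / (n * t))\<close> on boxes.
\<close>

section \<open>The space of square integrable functions\<close>

lemma L2_measurable: "f \<in> L2 \<Omega> \<Longrightarrow> f \<in> borel_measurable (lebesgue_on \<Omega>)"
  by (simp add: L2_def)

lemma L2_inner_integrable:
  assumes "f \<in> L2 \<Omega>" "g \<in> L2 \<Omega>"
  shows "integrable (lebesgue_on \<Omega>) (\<lambda>x. inner (f x) (g x))"
proof (rule Bochner_Integration.integrable_bound)
  show "integrable (lebesgue_on \<Omega>) (\<lambda>x. (norm (f x))\<^sup>2 + (norm (g x))\<^sup>2)"
    using assms by (auto simp: L2_def)
  show "(\<lambda>x. inner (f x) (g x)) \<in> borel_measurable (lebesgue_on \<Omega>)"
    using assms[THEN L2_measurable] by (rule borel_measurable_inner)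
  have "\<bar>inner a b\<bar> \<le> (norm a)\<^sup>2 + (norm b)\<^sup>2" for a b :: 'b
  proof -
    have "\<bar>inner a b\<bar> \<le> norm a * norm b" by (rule Cauchy_Schwarz_ineq2)
    also have "\<dots> \<le> (norm a)\<^sup>2 + (norm b)\<^sup>2"
      using sum_squares_bound[of "norm a" "norm b"] mult_nonneg_nonneg[OF norm_ge_zero[of a] norm_ge_zero[of b]]
      by linarith
    finally show ?thesis .
  qed
  then show "AE x in lebesgue_on \<Omega>. norm (inner (f x) (g x)) \<le> norm ((norm (f x))\<^sup>2 + (norm (g x))\<^sup>2)"
    by (simp add: abs_of_nonneg)
qed

text \<open>As an inner product the squared norm expands by bilinearity, which is how closure under
  sums is obtained.\<close>

lemma L2_iff_inner_integrable:
  "f \<in> L2 \<Omega> \<longleftrightarrow> f \<in> borel_measurable (lebesgue_on \<Omega>) \<and> integrable (lebesgue_on \<Omega>) (\<lambda>x. inner (f x) (f x))"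
  by (simp add: L2_def power2_norm_eq_inner)

lemma L2_add:
  assumes "f \<in> L2 \<Omega>" "g \<in> L2 \<Omega>"
  shows "(\<lambda>x. f x + g x) \<in> L2 \<Omega>"
  using assms[THEN L2_measurable] L2_inner_integrable[OF assms(1) assms(2)]
    L2_inner_integrable[OF assms(2) assms(1)] assms
  by (auto simp: L2_iff_inner_integrable inner_add intro!: Bochner_Integration.integrable_add)

lemma L2_scaleR: "f \<in> L2 \<Omega> \<Longrightarrow> (\<lambda>x. c *\<^sub>R f x) \<in> L2 \<Omega>"
  by (auto simp: L2_def power_mult_distrib)

lemma L2_cmult: "f \<in> L2 \<Omega> \<Longrightarrow> (\<lambda>x. c * f x :: real) \<in> L2 \<Omega>"
  using L2_scaleR[of f \<Omega> c] by simp

lemma L2_diff: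
  assumes "f \<in> L2 \<Omega>" "g \<in> L2 \<Omega>"
  shows "(\<lambda>x. f x - g x) \<in> L2 \<Omega>"
  using L2_add[OF assms(1) L2_scaleR[OF assms(2), of "-1"]] by simp

lemma L2_zero: "(\<lambda>x. 0) \<in> L2 \<Omega>"
  by (simp add: L2_def)

lemma L2_sum: "(\<And>i. i \<in> I \<Longrightarrow> f i \<in> L2 \<Omega>) \<Longrightarrow> (\<lambda>x. \<Sum>i\<in>I. f i x) \<in> L2 \<Omega>"
  by (induction I rule: infinite_finite_induct) (auto simp: L2_zero L2_add)

lemma L2_component:
  assumes "f \<in> L2 \<Omega>"
  shows "(\<lambda>x. inner (f x) b) \<in> L2 \<Omega>"
proof -
  have m: "(\<lambda>x. inner (f x) b) \<in> borel_measurable (lebesgue_on \<Omega>)"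
    using L2_measurable[OF assms] by simp
  moreover have "integrable (lebesgue_on \<Omega>) (\<lambda>x. (norm (inner (f x) b))\<^sup>2)"
  proof (rule Bochner_Integration.integrable_bound)
    show "integrable (lebesgue_on \<Omega>) (\<lambda>x. (norm (f x))\<^sup>2 * (norm b)\<^sup>2)"
      using assms by (simp add: L2_def)
    show "AE x in lebesgue_on \<Omega>. norm ((norm (inner (f x) b))\<^sup>2) \<le> norm ((norm (f x))\<^sup>2 * (norm b)\<^sup>2)"
      using Cauchy_Schwarz_ineq2[of _ b]
      by (auto simp: power_mult_distrib[symmetric] intro!: power2_le_iff_abs_le[THEN iffD2])
  qed (use m in measurable)
  ultimately show ?thesis
    by (simp add: L2_def)
qed

lemma l2_inner_commute: "l2_inner \<Omega> f g = l2_inner \<Omega> g f"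
  by (simp add: l2_inner_def inner_commute)

lemma l2_inner_add_left:
  assumes "f \<in> L2 \<Omega>" "g \<in> L2 \<Omega>" "h \<in> L2 \<Omega>"
  shows "l2_inner \<Omega> (\<lambda>x. f x + g x) h = l2_inner \<Omega> f h + l2_inner \<Omega> g h"
  unfolding l2_inner_def inner_add_left
  using assms by (intro Bochner_Integration.integral_add L2_inner_integrable)

lemma l2_inner_diff_left:
  assumes "f \<in> L2 \<Omega>" "g \<in> L2 \<Omega>" "h \<in> L2 \<Omega>"
  shows "l2_inner \<Omega> (\<lambda>x. f x - g x) h = l2_inner \<Omega> f h - l2_inner \<Omega> g h"
  unfolding l2_inner_def inner_diff_left
  using assms by (intro Bochner_Integration.integral_diff L2_inner_integrable)

lemma l2_inner_scaleR_left: "l2_inner \<Omega> (\<lambda>x. c *\<^sub>R f x) h = c * l2_inner \<Omega> f h"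
  by (simp add: l2_inner_def)

lemma l2_inner_scaleR_right: "l2_inner \<Omega> h (\<lambda>x. c *\<^sub>R f x) = c * l2_inner \<Omega> h f"
  by (simp add: l2_inner_def)

lemma l2_inner_sum_left:
  assumes "\<And>i. i \<in> I \<Longrightarrow> f i \<in> L2 \<Omega>" "h \<in> L2 \<Omega>"
  shows "l2_inner \<Omega> (\<lambda>x. \<Sum>i\<in>I. c i *\<^sub>R f i x) h = (\<Sum>i\<in>I. c i * l2_inner \<Omega> (f i) h)"
  unfolding l2_inner_def inner_sum_left
  using assms by (subst Bochner_Integration.integral_sum) (auto intro!: integrable_mult_right L2_inner_integrable)

lemma l2_inner_add_right:
  assumes "f \<in> L2 \<Omega>" "g \<in> L2 \<Omega>" "h \<in> L2 \<Omega>"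
  shows "l2_inner \<Omega> h (\<lambda>x. f x + g x) = l2_inner \<Omega> h f + l2_inner \<Omega> h g"
  using l2_inner_add_left[OF assms] by (simp add: l2_inner_commute)

lemma l2_inner_sum_right:
  assumes "\<And>i. i \<in> I \<Longrightarrow> f i \<in> L2 \<Omega>" "h \<in> L2 \<Omega>"
  shows "l2_inner \<Omega> h (\<lambda>x. \<Sum>i\<in>I. c i *\<^sub>R f i x) = (\<Sum>i\<in>I. c i * l2_inner \<Omega> h (f i))"
  using l2_inner_sum_left[OF assms] by (simp add: l2_inner_commute)

lemma l2_inner_cong_AE:
  assumes "AE x in lebesgue_on \<Omega>. f x = f' x" "AE x in lebesgue_on \<Omega>. g x = g' x"
    and "f \<in> L2 \<Omega>" "g \<in> L2 \<Omega>" "f' \<in> L2 \<Omega>" "g' \<in> L2 \<Omega>"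
  shows "l2_inner \<Omega> f g = l2_inner \<Omega> f' g'"
  unfolding l2_inner_def
proof (rule integral_cong_AE)
  show "AE x in lebesgue_on \<Omega>. inner (f x) (g x) = inner (f' x) (g' x)"
    using assms(1,2) by eventually_elim simp
qed (intro borel_measurable_inner L2_measurable assms)+

lemma l2_inner_ge_0: "0 \<le> l2_inner \<Omega> f f"
  by (simp add: l2_inner_def)

lemma l2_norm_ge_0: "0 \<le> l2_norm \<Omega> f"
  by (simp add: l2_norm_def l2_inner_ge_0)

lemma l2_norm_power2: "(l2_norm \<Omega> f)\<^sup>2 = l2_inner \<Omega> f f"
  by (simp add: l2_norm_def l2_inner_ge_0)

lemma l2_norm_cong_AE:
  assumes "AE x in lebesgue_on \<Omega>. f x = f' x" "f \<in> L2 \<Omega>" "f' \<in> L2 \<Omega>"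
  shows "l2_norm \<Omega> f = l2_norm \<Omega> f'"
  using l2_inner_cong_AE[OF assms(1,1) assms(2,2) assms(3,3)] by (simp add: l2_norm_def)

lemma l2_norm_scaleR: "l2_norm \<Omega> (\<lambda>x. c *\<^sub>R f x) = \<bar>c\<bar> * l2_norm \<Omega> f"
proof -
  have "l2_inner \<Omega> (\<lambda>x. c *\<^sub>R f x) (\<lambda>x. c *\<^sub>R f x) = c\<^sup>2 * l2_inner \<Omega> f f"
    by (simp add: l2_inner_def power2_eq_square mult.assoc)
  then show ?thesis
    by (simp add: l2_norm_def real_sqrt_mult)
qed

text \<open>Functions are not identified modulo null sets, so \<open>l2_inner\<close> is only
  positive semidefinite. The nonnegative quadratic form \<open>q\<close> in two parameters gives the
  discriminant inequality, with \<open>?c = 0\<close> as a separate degenerate case.\<close>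

lemma l2_Cauchy_Schwarz:
  assumes f: "f \<in> L2 \<Omega>" and g: "g \<in> L2 \<Omega>"
  shows "\<bar>l2_inner \<Omega> f g\<bar> \<le> l2_norm \<Omega> f * l2_norm \<Omega> g"
proof -
  let ?a = "l2_inner \<Omega> f f" and ?b = "l2_inner \<Omega> f g" and ?c = "l2_inner \<Omega> g g"
  have q: "0 \<le> s\<^sup>2 * ?a + 2 * s * t * ?b + t\<^sup>2 * ?c" for s t
  proof -
    let ?h = "\<lambda>x. s *\<^sub>R f x + t *\<^sub>R g x"
    have sf: "(\<lambda>x. s *\<^sub>R f x) \<in> L2 \<Omega>" and tg: "(\<lambda>x. t *\<^sub>R g x) \<in> L2 \<Omega>"
      using f g by (auto intro: L2_scaleR)
    have h: "?h \<in> L2 \<Omega>" by (rule L2_add[OF sf tg])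
    have "l2_inner \<Omega> ?h ?h = s * l2_inner \<Omega> f ?h + t * l2_inner \<Omega> g ?h"
      by (simp add: l2_inner_add_left[OF sf tg h] l2_inner_scaleR_left)
    also have "l2_inner \<Omega> f ?h = s * ?a + t * ?b"
      by (simp add: l2_inner_add_right[OF sf tg f] l2_inner_scaleR_right)
    also have "l2_inner \<Omega> g ?h = s * ?b + t * ?c"
      by (simp add: l2_inner_add_right[OF sf tg g] l2_inner_scaleR_right l2_inner_commute[of \<Omega> g f])
    finally show ?thesis
      using l2_inner_ge_0[of \<Omega> ?h] by (simp add: power2_eq_square algebra_simps)
  qed
  have "?b\<^sup>2 \<le> ?a * ?c"
  proof (cases "?c = 0")
    case True
    have "?b = 0"
    proof (rule ccontr)
      assume "?b \<noteq> 0"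
      \<comment> \<open>This \<open>t\<close> makes \<open>?a + 2 * t * ?b\<close> equal to
        -1.\<close>
      define t where "t = - (?a + 1) / (2 * ?b)"
      have "2 * t * ?b = - (?a + 1)"
        using \<open>?b \<noteq> 0\<close> by (simp add: t_def)
      moreover have "0 \<le> ?a + 2 * t * ?b"
        using q[of 1 t] True by simp
      ultimately show False by linarith
    qed
    then show ?thesis using True by simp
  next
    case False
    then have "?c > 0" using l2_inner_ge_0[of \<Omega> g] by simp
    \<comment> \<open>At \<open>s = ?c\<close> and \<open>t = - ?b\<close> the form \<open>q\<close>
      factors into this product.\<close>
    moreover have "?c * (?a * ?c - ?b\<^sup>2) \<ge> 0"
      using q[of "?c" "- ?b"] by (simp add: power2_eq_square algebra_simps)
    ultimately show ?thesis
      by (simp add: zero_le_mult_iff)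
  qed
  then show ?thesis
    using real_sqrt_le_mono[of "?b\<^sup>2" "?a * ?c"] by (simp add: l2_norm_def real_sqrt_mult)
qed

lemma l2_norm_triangle:
  assumes f: "f \<in> L2 \<Omega>" and g: "g \<in> L2 \<Omega>"
  shows "l2_norm \<Omega> (\<lambda>x. f x + g x) \<le> l2_norm \<Omega> f + l2_norm \<Omega> g"
proof (rule power2_le_imp_le)
  have "l2_inner \<Omega> (\<lambda>x. f x + g x) (\<lambda>x. f x + g x) = l2_inner \<Omega> f f + 2 * l2_inner \<Omega> f g + l2_inner \<Omega> g g"
    using f g by (simp add: l2_inner_add_left l2_inner_add_right L2_add l2_inner_commute[of \<Omega> g f])
  then show "(l2_norm \<Omega> (\<lambda>x. f x + g x))\<^sup>2 \<le> (l2_norm \<Omega> f + l2_norm \<Omega> g)\<^sup>2"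
    using l2_Cauchy_Schwarz[OF f g] by (simp add: l2_norm_power2 power2_sum)
qed (simp add: l2_norm_ge_0)

section \<open>Smooth functions\<close>

text \<open>In the product rule each factor also occurs undifferentiated, so the induction in
  \<open>Ck_mult\<close> has to lower the order of the factors by one.\<close>

lemma Ck_mono: "Ck (Suc n) f \<Longrightarrow> Ck n f"
proof (induction n arbitrary: f)
  case 0
  then show ?case
    by (auto intro: differentiable_imp_continuous_on)
next
  case (Suc n)
  then show ?case
    by (metis Ck.simps(2))
qed

lemma frechet_derivative_add_at:
  assumes "f differentiable (at x)" "g differentiable (at x)"
  shows "frechet_derivative (\<lambda>x. f x + g x) (at x) b
    = frechet_derivative f (at x) b + frechet_derivative g (at x) b"
  using fun_cong[OF frechet_derivative_at[OF has_derivative_add[OF assms[THEN frechet_derivative_works[THEN iffD1]]]], of b]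
  by simp

lemma frechet_derivative_mult_at:
  fixes f g :: "'a::real_normed_vector \<Rightarrow> real"
  assumes "f differentiable (at x)" "g differentiable (at x)"
  shows "frechet_derivative (\<lambda>x. f x * g x) (at x) b
    = f x * frechet_derivative g (at x) b + frechet_derivative f (at x) b * g x"
  using fun_cong[OF frechet_derivative_at[OF has_derivative_mult[OF assms[THEN frechet_derivative_works[THEN iffD1]]]], of b]
  by simp

lemma Ck_add:
  assumes "Ck n f" "Ck n g"
  shows "Ck n (\<lambda>x. f x + g x)"
  using assms
proof (induction n arbitrary: f g)
  case 0
  then show ?case by (simp add: continuous_on_add)
next
  case (Suc n)
  have d: "f differentiable (at x)" "g differentiable (at x)" for x
    using Suc.prems by (auto simp: differentiable_on_def)
  then show ?case
    using Suc d by (auto simp: differentiable_on_def frechet_derivative_add_at)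
qed

lemma Ck_mult:
  assumes "Ck n f" "Ck n g"
  shows "Ck n (\<lambda>x. f x * g x)"
  using assms
proof (induction n arbitrary: f g)
  case 0
  then show ?case by (simp add: continuous_on_mult)
next
  case (Suc n)
  have d: "f differentiable (at x)" "g differentiable (at x)" for x
    using Suc.prems by (auto simp: differentiable_on_def)
  have "Ck n f" "Ck n g"
    using Suc.prems by (auto intro: Ck_mono)
  then show ?case
    using Suc d by (auto simp: differentiable_on_def frechet_derivative_mult_at intro!: Ck_add)
qed

lemma Ck_const: "Ck n (\<lambda>x. c)"
proof (induction n arbitrary: c)
  case (Suc n)
  then show ?case by (simp add: frechet_derivative_const)
qed simp

lemma Ck_prod:
  "(\<And>i. i \<in> I \<Longrightarrow> Ck n (f i)) \<Longrightarrow> Ck n (\<lambda>x. \<Prod>i\<in>I. f i x)"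
  by (induction I rule: infinite_finite_induct) (auto simp: Ck_const Ck_mult)

section \<open>A smooth function vanishing on the nonpositive reals\<close>

text \<open>Closed under differentiation, since \<open>(poly p (1/t) exp(-1/t))' = poly q (1/t) exp(-1/t)\<close>
  with \<open>q = X\<^sup>2 (p - p')\<close>.\<close>

definition smooth_step :: "real poly \<Rightarrow> real \<Rightarrow> real" where
  "smooth_step p t = (if t \<le> 0 then 0 else poly p (1 / t) * exp (- 1 / t))"

text \<open>Exponential decay beats every power. With y = 1/t this is the flatness of
  \<open>smooth_step p\<close> at zero from the right.\<close>

lemma poly_mult_exp_neg_tendsto_0: "((\<lambda>y::real. poly p y * exp (- y)) \<longlongrightarrow> 0) at_top"
proof (induction p)
  case (pCons a p)
  have *: "((\<lambda>y::real. poly p y * y / exp y) \<longlongrightarrow> 0) at_top" for p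
  proof -
    have "((\<lambda>y::real. \<Sum>i\<le>degree p. coeff p i * (y ^ Suc i / exp y)) \<longlongrightarrow> (\<Sum>i\<le>degree p. coeff p i * 0)) at_top"
      by (intro tendsto_sum tendsto_mult tendsto_const tendsto_power_div_exp_0)
    moreover have "(\<Sum>i\<le>degree p. coeff p i * (y ^ Suc i / exp y)) = poly p y * y / exp y" for y
      unfolding poly_altdef sum_distrib_right sum_divide_distrib
      by (intro sum.cong) (auto simp: mult_ac)
    ultimately show ?thesis
      by simp
  qed
  have "((\<lambda>y::real. a * (y ^ 0 / exp y) + poly p y * y / exp y) \<longlongrightarrow> a * 0 + 0) at_top"
    by (intro tendsto_add tendsto_mult tendsto_const tendsto_power_div_exp_0 *)
  then show ?case
    by (simp add: exp_minus field_simps)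
qed simp

lemma smooth_step_has_derivative:
  "(smooth_step p has_real_derivative smooth_step (monom 1 2 * (p - pderiv p)) t) (at t)"
proof -
  consider "t < 0" | "t = 0" | "t > 0" by linarith
  then show ?thesis
  proof cases
    case 1
    have "((\<lambda>_. 0) has_real_derivative 0) (at t)" by simp
    moreover have "\<forall>\<^sub>F x in nhds t. smooth_step p x = 0"
      using eventually_nhds_in_open[of "{..<0}" t] 1
      by (auto simp: smooth_step_def elim!: eventually_mono)
    ultimately show ?thesis
      using 1 by (subst DERIV_cong_ev[OF refl _ refl]) (auto simp: smooth_step_def)
  next
    case 2
    have "((\<lambda>x. (smooth_step p x - smooth_step p 0) / (x - 0)) \<longlongrightarrow> 0) (at 0)"
    proof (rule filterlim_split_at)
      show "((\<lambda>x. (smooth_step p x - smooth_step p 0) / (x - 0)) \<longlongrightarrow> 0) (at_left 0)"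
        by (rule tendsto_eventually)
           (auto simp: smooth_step_def eventually_at_left_field intro!: exI[of _ "-1"])
      \<comment> \<open>Division by \<open>x\<close> is one more factor \<open>inverse x\<close>, so
        the difference quotient at zero belongs to the polynomial \<open>pCons 0 p\<close>, that is
        X times \<open>p\<close>.\<close>
      have "((\<lambda>x. poly (pCons 0 p) (inverse x) * exp (- (inverse x))) \<longlongrightarrow> 0) (at_right (0::real))"
        by (rule filterlim_compose[OF poly_mult_exp_neg_tendsto_0 filterlim_inverse_at_top_right])
      moreover have "\<forall>\<^sub>F x in at_right 0. poly (pCons 0 p) (inverse x) * exp (- (inverse x))
          = (smooth_step p x - smooth_step p 0) / (x - 0)"
        by (auto simp: smooth_step_def eventually_at_right_field field_simps intro!: exI[of _ "1"])
      ultimately show "((\<lambda>x. (smooth_step p x - smooth_step p 0) / (x - 0)) \<longlongrightarrow> 0) (at_right 0)"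
        by (rule Lim_transform_eventually)
    qed
    then show ?thesis
      using 2 by (simp add: has_field_derivative_iff smooth_step_def)
  next
    case 3
    have "((\<lambda>x. poly p (1 / x) * exp (- 1 / x)) has_real_derivative
        poly (monom 1 2 * (p - pderiv p)) (1 / t) * exp (- 1 / t)) (at t)"
      using 3 by (auto intro!: derivative_eq_intros simp: poly_monom field_simps power2_eq_square)
    moreover have "\<forall>\<^sub>F x in nhds t. smooth_step p x = poly p (1 / x) * exp (- 1 / x)"
      using eventually_nhds_in_open[of "{0<..}" t] 3
      by (auto simp: smooth_step_def elim!: eventually_mono)
    ultimately show ?thesis
      using 3 by (subst DERIV_cong_ev[OF refl _ refl]) (auto simp: smooth_step_def)
  qed
qed

text \<open>The induction runs over arbitrary \<open>p\<close>, because a partial derivative is a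
  constant multiple of a function of the same shape with another polynomial. Affine arguments are
  those of the faces of a box.\<close>

lemma Ck_smooth_step: "Ck n (\<lambda>x::'a::euclidean_space. smooth_step p (inner x a + c))"
proof (induction n arbitrary: p)
  have hd: "((\<lambda>x::'a. smooth_step p (inner x a + c)) has_derivative
      (\<lambda>h. smooth_step (monom 1 2 * (p - pderiv p)) (inner x a + c) * inner h a)) (at x)" for p x
  proof -
    have "((\<lambda>x. inner x a + c) has_derivative (\<lambda>h. inner h a)) (at x)"
      by (auto intro!: derivative_eq_intros)
    from has_derivative_compose[OF this
        smooth_step_has_derivative[of p "inner x a + c", unfolded has_field_derivative_def]]
    show ?thesis by simp
  qed
  have dif: "(\<lambda>x::'a. smooth_step p (inner x a + c)) differentiable_on UNIV" for p
    using hd[of p] unfolding differentiable_on_def differentiable_def by blast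
  {
    case 0
    show ?case
      using dif[of p] by (simp add: differentiable_imp_continuous_on)
  next
    case (Suc n)
    have fd: "frechet_derivative (\<lambda>x::'a. smooth_step p (inner x a + c)) (at x) b
      = smooth_step (monom 1 2 * (p - pderiv p)) (inner x a + c) * inner b a" for x b
      using fun_cong[OF frechet_derivative_at[OF hd[of p x]], of b] by simp
    show ?case
      unfolding Ck.simps fd
      using dif[of p] Suc by (auto intro!: Ck_mult Ck_const)
  }
qed

section \<open>Test functions\<close>

lemma zero_outside_closure_support: "x \<notin> closure {x. \<psi> x \<noteq> 0} \<Longrightarrow> \<psi> x = (0::real)"
  using closure_subset[of "{x. \<psi> x \<noteq> 0}"] by auto

lemma test_functions_differentiable: "\<psi> \<in> test_functions \<Omega> \<Longrightarrow> \<psi> differentiable (at x)"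
proof -
  assume "\<psi> \<in> test_functions \<Omega>"
  then have "Ck (Suc 0) \<psi>" by (simp only: test_functions_def mem_Collect_eq)
  then show ?thesis by (simp add: differentiable_on_def)
qed

lemma test_functions_continuous_derivative:
  "\<psi> \<in> test_functions \<Omega> \<Longrightarrow> b \<in> Basis \<Longrightarrow> continuous_on UNIV (\<lambda>x. frechet_derivative \<psi> (at x) b)"
proof -
  assume "\<psi> \<in> test_functions \<Omega>" "b \<in> Basis"
  moreover from this have "Ck (Suc 0) \<psi>" by (simp only: test_functions_def mem_Collect_eq)
  ultimately show ?thesis by simp
qed

lemma frechet_derivative_outside_support:
  assumes "x \<notin> closure {x. \<psi> x \<noteq> (0::real)}"
  shows "frechet_derivative \<psi> (at x) b = 0"
proof -
  have "((\<lambda>_. 0) has_derivative (\<lambda>_. 0)) (at x)" by simp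
  moreover have "open (- closure {x. \<psi> x \<noteq> 0})" by auto
  ultimately have "(\<psi> has_derivative (\<lambda>_. 0)) (at x)"
    by (rule has_derivative_transform_within_open)
       (use assms in \<open>auto dest: zero_outside_closure_support\<close>)
  from frechet_derivative_at[OF this] show ?thesis by metis
qed

text \<open>Serves test functions and their partial derivatives alike, since both vanish outside the
  same compact set.\<close>

lemma L2_continuous_compact_support:
  fixes h :: "'a::euclidean_space \<Rightarrow> real"
  assumes "\<Omega> \<in> sets lebesgue" and h: "continuous_on UNIV h" and K: "compact K" "\<And>x. x \<notin> K \<Longrightarrow> h x = 0"
  shows "h \<in> L2 \<Omega>"
proof -
  have "h \<in> borel_measurable borel"
    using h by (rule borel_measurable_continuous_onI)
  then have "h \<in> borel_measurable (lebesgue_on \<Omega>)"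
    by (intro measurable_restrict_space1 measurable_completion) simp
  moreover have "integrable lborel (\<lambda>x. indicator K x *\<^sub>R (norm (h x))\<^sup>2)"
    using K h by (intro borel_integrable_compact continuous_intros) (auto intro: continuous_on_subset)
  then have "integrable lebesgue (\<lambda>x. indicator K x *\<^sub>R (norm (h x))\<^sup>2)"
    by (intro integrable_completion[THEN iffD2]) auto
  then have "integrable lebesgue (\<lambda>x. (norm (h x))\<^sup>2)"
    by (rule back_subst[where P = "integrable lebesgue"]) (auto simp: indicator_def K fun_eq_iff)
  then have "integrable (lebesgue_on \<Omega>) (\<lambda>x. (norm (h x))\<^sup>2)"
    using integrable_mult_indicator[OF assms(1), of "\<lambda>x. (norm (h x))\<^sup>2"] assms(1)
    by (simp add: integrable_restrict_space)
  ultimately show ?thesis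
    by (simp add: L2_def)
qed

lemma test_functions_L2:
  assumes "\<Omega> \<in> sets lebesgue" "\<psi> \<in> test_functions \<Omega>"
  shows "\<psi> \<in> L2 \<Omega>"
proof (rule L2_continuous_compact_support[OF assms(1)])
  have "Ck 0 \<psi>" using assms by (simp only: test_functions_def mem_Collect_eq)
  then show "continuous_on UNIV \<psi>" by simp
  show "compact (closure {x. \<psi> x \<noteq> 0})"
    using assms by (simp add: test_functions_def)
qed (rule zero_outside_closure_support)

lemma test_functions_derivative_L2:
  assumes "\<Omega> \<in> sets lebesgue" "\<psi> \<in> test_functions \<Omega>" "b \<in> Basis"
  shows "(\<lambda>x. frechet_derivative \<psi> (at x) b) \<in> L2 \<Omega>"
proof (rule L2_continuous_compact_support[OF assms(1) test_functions_continuous_derivative[OF assms(2,3)]])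
  show "compact (closure {x. \<psi> x \<noteq> 0})"
    using assms by (simp add: test_functions_def)
qed (rule frechet_derivative_outside_support)

lemma gradient_L2:
  assumes "\<Omega> \<in> sets lebesgue" "\<psi> \<in> test_functions \<Omega>"
  shows "gradient \<psi> \<in> L2 \<Omega>"
proof -
  have "(\<lambda>x. \<Sum>b\<in>Basis. frechet_derivative \<psi> (at x) b *\<^sub>R b) \<in> L2 \<Omega>"
  proof (rule L2_sum)
    fix b :: 'a assume b: "b \<in> Basis"
    note d = test_functions_derivative_L2[OF assms b]
    have "(\<lambda>x. frechet_derivative \<psi> (at x) b *\<^sub>R b) \<in> borel_measurable (lebesgue_on \<Omega>)"
      using L2_measurable[OF d] by simp
    then show "(\<lambda>x. frechet_derivative \<psi> (at x) b *\<^sub>R b) \<in> L2 \<Omega>"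
      using d b by (simp add: L2_def)
  qed
  then show ?thesis
    by (simp add: gradient_def[abs_def])
qed

lemma test_functions_add:
  assumes "\<psi> \<in> test_functions \<Omega>" "\<theta> \<in> test_functions \<Omega>"
  shows "(\<lambda>x. \<psi> x + \<theta> x) \<in> test_functions \<Omega>"
proof -
  have "closure {x. \<psi> x + \<theta> x \<noteq> 0} \<subseteq> closure {x. \<psi> x \<noteq> 0} \<union> closure {x. \<theta> x \<noteq> 0}"
    unfolding closure_Un[symmetric] by (rule closure_mono) auto
  moreover have "compact (closure {x. \<psi> x + \<theta> x \<noteq> 0})"
    using assms
    by (auto simp: test_functions_def intro: bounded_subset[of "{x. \<psi> x \<noteq> 0} \<union> {x. \<theta> x \<noteq> 0}"])
  ultimately show ?thesis
    using assms by (auto simp: test_functions_def Ck_add)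
qed

lemma test_functions_cmult:
  assumes "\<psi> \<in> test_functions \<Omega>"
  shows "(\<lambda>x. c * \<psi> x) \<in> test_functions \<Omega>"
\<comment> \<open>For \<open>c \<noteq> 0\<close> the support is that of \<psi>; for
  \<open>c = 0\<close> it is empty.\<close>
proof (cases "c = 0")
  case False
  then show ?thesis
    using assms by (auto simp: test_functions_def intro!: Ck_mult Ck_const)
qed (use Ck_const[of _ 0] in \<open>auto simp: test_functions_def\<close>)

lemma gradient_add:
  assumes "\<psi> \<in> test_functions \<Omega>" "\<theta> \<in> test_functions \<Omega>"
  shows "gradient (\<lambda>x. \<psi> x + \<theta> x) x = gradient \<psi> x + gradient \<theta> x"
  using assms[THEN test_functions_differentiable]
  by (simp add: gradient_def frechet_derivative_add_at algebra_simps sum.distrib)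

lemma gradient_cmult:
  assumes "\<psi> \<in> test_functions \<Omega>"
  shows "gradient (\<lambda>x. c * \<psi> x) x = c *\<^sub>R gradient \<psi> x"
  using frechet_derivative_mult_at[OF differentiable_const test_functions_differentiable[OF assms], of c]
  by (simp add: gradient_def scaleR_sum_right)

text \<open>Each factor is exp (- 1 / (n * s)), where s is the signed distance to a face: zero for s
  \<le> 0, and tending to 1 with growing n for s > 0. Scaling by n thus approximates the indicator
  of the open box while nothing leaks out of it.\<close>

definition box_bump :: "'a::euclidean_space \<Rightarrow> 'a \<Rightarrow> nat \<Rightarrow> 'a \<Rightarrow> real" where
  "box_bump a b n x = (\<Prod>i\<in>Basis. smooth_step 1 (real n * (inner x i - inner a i)) *
                                  smooth_step 1 (real n * (inner b i - inner x i)))"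

lemma box_bump_outside:
  assumes "x \<notin> box a b"
  shows "box_bump a b n x = 0"
proof -
  obtain i where "i \<in> Basis" "inner x i \<le> inner a i \<or> inner b i \<le> inner x i"
    using assms by (auto simp: mem_box not_less)
  moreover from this have "smooth_step 1 (real n * (inner x i - inner a i)) *
      smooth_step 1 (real n * (inner b i - inner x i)) = 0"
    by (auto simp: smooth_step_def mult_nonneg_nonpos)
  ultimately show ?thesis
    unfolding box_bump_def by (intro prod_zero) auto
qed

lemma Ck_box_bump: "Ck k (box_bump a b n)"
proof -
  have "Ck k (\<lambda>x. smooth_step 1 (real n * (inner x i - inner a i)) *
                   smooth_step 1 (real n * (inner b i - inner x i)))" for i :: 'a
    using Ck_mult[OF Ck_smooth_step[of k 1 "real n *\<^sub>R i" "- real n * inner a i"]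
        Ck_smooth_step[of k 1 "- real n *\<^sub>R i" "real n * inner b i"]]
    by (simp add: algebra_simps)
  then show ?thesis
    unfolding box_bump_def[abs_def] by (intro Ck_prod)
qed

text \<open>The support is a closure, so it may reach the faces of the box; hence the closed box has
  to lie in \<Omega>.\<close>

lemma box_bump_test_function:
  assumes "cbox a b \<subseteq> \<Omega>"
  shows "box_bump a b n \<in> test_functions \<Omega>"
proof -
  have "{x. box_bump a b n x \<noteq> 0} \<subseteq> cbox a b"
    using box_bump_outside[of _ a b n] box_subset_cbox by blast
  then have "bounded {x. box_bump a b n x \<noteq> 0}" and "closure {x. box_bump a b n x \<noteq> 0} \<subseteq> cbox a b"
    using bounded_subset[OF bounded_cbox] closure_minimal[OF _ closed_cbox] by blast+
  then show ?thesis
    using assms by (auto simp: test_functions_def Ck_box_bump)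
qed

lemma smooth_step_1_bounds: "0 \<le> smooth_step 1 t" "smooth_step 1 t \<le> 1"
  by (auto simp: smooth_step_def)

lemma box_bump_bounds: "0 \<le> box_bump a b n x" "box_bump a b n x \<le> 1"
  unfolding box_bump_def
  by (auto intro!: prod_nonneg prod_le_1 mult_nonneg_nonneg mult_le_one smooth_step_1_bounds)

lemma box_bump_tendsto_indicator: "(\<lambda>n. box_bump a b n x) \<longlonglongrightarrow> indicator (box a b) x"
proof (cases "x \<in> box a b")
  case True
  have st: "(\<lambda>n. smooth_step 1 (real n * t)) \<longlonglongrightarrow> 1" if "t > 0" for t
  proof -
    have "(\<lambda>n. exp (- (1 / t) * (1 / real n))) \<longlonglongrightarrow> exp (- (1 / t) * 0)"
      by (intro tendsto_intros lim_1_over_n)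
    \<comment> \<open>At \<open>n = 0\<close> division by zero makes the exponential 1 while the
      step is 0, so the two sequences agree only for positive \<open>n\<close>.\<close>
    moreover have "\<forall>\<^sub>F n in sequentially. exp (- (1 / t) * (1 / real n)) = smooth_step 1 (real n * t)"
      by (rule eventually_mono[OF eventually_gt_at_top[of 0]])
         (use that in \<open>auto simp: smooth_step_def mult_le_0_iff field_simps\<close>)
    ultimately show ?thesis
      using Lim_transform_eventually by fastforce
  qed
  have "(\<lambda>n. box_bump a b n x) \<longlonglongrightarrow> (\<Prod>i\<in>(Basis::'a set). 1 * 1)"
    unfolding box_bump_def using True
    by (intro tendsto_prod tendsto_mult st) (auto simp: mem_box)
  then show ?thesis
    using True by simp
qed (simp add: box_bump_outside)

section \<open>The fundamental lemma of the calculus of variations\<close>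

text \<open>Test with \<open>box_bump a b n\<close> and let \<open>n\<close> grow. Dominated
  convergence applies with the majorant \<bar>g\<bar> on the closed box, which is integrable as a
  product of two square integrable functions.\<close>

lemma integral_box_eq_0:
  fixes g :: "'a::euclidean_space \<Rightarrow> real"
  assumes "open \<Omega>" and g: "g \<in> L2 \<Omega>"
    and orth: "\<And>\<psi>. \<psi> \<in> test_functions \<Omega> \<Longrightarrow> (LINT x|lebesgue_on \<Omega>. g x * \<psi> x) = 0"
    and sub: "cbox a b \<subseteq> \<Omega>"
  shows "integrable (lebesgue_on \<Omega>) (\<lambda>x. g x * indicator (box a b) x)"
    and "(LINT x|lebesgue_on \<Omega>. g x * indicator (box a b) x) = 0"
proof -
  have \<Omega>: "\<Omega> \<in> sets lebesgue" using assms(1) by auto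
  have "(indicator (cbox a b) :: 'a \<Rightarrow> real) \<in> L2 \<Omega>"
  proof -
    have "integrable (lebesgue_on \<Omega>) (indicator (cbox a b) :: 'a \<Rightarrow> real)"
    proof -
      have "integrable lebesgue (indicator (cbox a b) :: 'a \<Rightarrow> real)"
        by (intro integrable_real_indicator) (auto simp: emeasure_lborel_cbox_eq)
      from integrable_mult_indicator[OF \<Omega> this] show ?thesis
        using \<Omega> by (simp add: integrable_restrict_space)
    qed
    moreover have "(\<lambda>x::'a. (norm (indicator (cbox a b) x :: real))\<^sup>2) = indicator (cbox a b)"
      by (auto simp: indicator_def)
    ultimately show ?thesis
      by (simp add: L2_def borel_measurable_integrable)
  qed
  from L2_inner_integrable[OF g this]
  have int: "integrable (lebesgue_on \<Omega>) (\<lambda>x. g x * indicator (cbox a b) x)"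
    by simp
  have m: "(\<lambda>x. g x * indicator (box a b) x) \<in> borel_measurable (lebesgue_on \<Omega>)"
    by (intro borel_measurable_times L2_measurable[OF g] measurable_restrict_space1 borel_measurable_indicator) auto
  have bd: "\<bar>box_bump a b n x\<bar> \<le> indicator (cbox a b) x" for n x
    using box_bump_outside[of x a b n] box_bump_bounds[of a b n x] box_subset_cbox[of a b]
    by (auto simp: indicator_def)
  show "integrable (lebesgue_on \<Omega>) (\<lambda>x. g x * indicator (box a b) x)"
    using box_subset_cbox[of a b]
    by (intro Bochner_Integration.integrable_bound[OF int m]) (auto simp: indicator_def)
  have "(\<lambda>n. LINT x|lebesgue_on \<Omega>. g x * box_bump a b n x)
      \<longlonglongrightarrow> (LINT x|lebesgue_on \<Omega>. g x * indicator (box a b) x)"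
  proof (rule integral_dominated_convergence[where w = "\<lambda>x. \<bar>g x * indicator (cbox a b) x\<bar>"])
    show "integrable (lebesgue_on \<Omega>) (\<lambda>x. \<bar>g x * indicator (cbox a b) x\<bar>)"
      using int by (rule integrable_abs)
    show "(\<lambda>x. g x * box_bump a b n x) \<in> borel_measurable (lebesgue_on \<Omega>)" for n
      using L2_measurable[OF g] L2_measurable[OF test_functions_L2[OF \<Omega> box_bump_test_function[OF sub]]]
      by (rule borel_measurable_times)
    show "AE x in lebesgue_on \<Omega>. norm (g x * box_bump a b n x) \<le> \<bar>g x * indicator (cbox a b) x\<bar>" for n
      using bd by (auto simp: abs_mult intro!: mult_left_mono)
    show "AE x in lebesgue_on \<Omega>. (\<lambda>n. g x * box_bump a b n x) \<longlonglongrightarrow> g x * indicator (box a b) x"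
      by (intro AE_I2 tendsto_mult tendsto_const box_bump_tendsto_indicator)
  qed (rule m)
  then show "(LINT x|lebesgue_on \<Omega>. g x * indicator (box a b) x) = 0"
    by (simp add: orth[OF box_bump_test_function[OF sub]] LIMSEQ_const_iff)
qed

text \<open>A countable cover by Borel sets of finite measure survives completion.
  \<open>density_zero\<close> asks for this.\<close>

lemma sigma_finite_lebesgue: "sigma_finite_measure (lebesgue :: 'a::euclidean_space measure)"
proof -
  obtain A :: "'a set set" where A: "countable A \<and> A \<subseteq> sets lborel \<and> \<Union>A = space lborel \<and>
      (\<forall>a\<in>A. emeasure lborel a \<noteq> \<infinity>)"
    using sigma_finite_measure.sigma_finite_countable[OF sigma_finite_lborel] by (elim exE)
  have "emeasure lebesgue a \<noteq> \<infinity>" if "a \<in> A" for a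
  proof -
    have "a \<in> sets lborel" using A that by blast
    then have "emeasure lebesgue a = emeasure lborel a" by simp
    then show ?thesis using A that by simp
  qed
  moreover have "A \<subseteq> sets lebesgue"
    using A sets_completionI_sets by blast
  ultimately show ?thesis
    unfolding sigma_finite_measure_def using A by (intro exI[of _ A]) simp
qed

text \<open>Sets over which \<open>h\<close> integrates to zero are closed under complements, by
  \<open>tot\<close>, and under countable disjoint unions. Open boxes are stable under intersection
  and generate the Borel sets, so all Borel sets qualify, then all Lebesgue sets, and a function
  with only zero integrals vanishes almost everywhere.\<close>

lemma AE_zero_if_box_integrals_zero:
  fixes h :: "'a::euclidean_space \<Rightarrow> real"
  assumes int: "integrable lebesgue h" and tot: "integral\<^sup>L lebesgue h = 0"
    and box: "\<And>a b. set_lebesgue_integral lebesgue (box a b) h = 0"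
  shows "AE x in lebesgue. h x = 0"
proof (rule sigma_finite_measure.density_zero[OF sigma_finite_lebesgue int])
  have si: "set_integrable lebesgue A h" if "A \<in> sets lebesgue" for A
    unfolding set_integrable_def using that int by (rule integrable_mult_indicator)
  have borel: "set_lebesgue_integral lebesgue A h = 0" if "A \<in> sets borel" for A
  proof -
    have "Int_stable (range (\<lambda>(a::'a, b). box a b))"
      by (auto simp: Int_stable_def box_Int_box)
    moreover have "(range (\<lambda>(a::'a, b). box a b)) \<subseteq> Pow UNIV"
      by auto
    moreover have "A \<in> sigma_sets UNIV (range (\<lambda>(a, b). box a b))"
      using that unfolding borel_eq_box by simp
    ultimately show ?thesis
    proof (induction rule: sigma_sets_induct_disjoint)
      case (basic A)
      then show ?case using box by auto
    next
      case (compl A)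
      then have A: "A \<in> sets lebesgue"
        by (metis borel_eq_box sets_completionI_sets sets_lborel sets_measure_of subset_Pow_Union Union_UNIV Pow_UNIV top_greatest)
      have "set_lebesgue_integral lebesgue (A \<union> (UNIV - A)) h
          = set_lebesgue_integral lebesgue A h + set_lebesgue_integral lebesgue (UNIV - A) h"
        using A by (intro set_integral_Un si) auto
      then show ?case
        using compl tot by (simp add: set_lebesgue_integral_def)
    next
      case (union F)
      then have F: "F i \<in> sets lebesgue" for i
        by (metis borel_eq_box sets_completionI_sets sets_lborel sets_measure_of Pow_UNIV top_greatest range_subsetD)
      have "set_lebesgue_integral lebesgue (\<Union>i. F i) h = (\<Sum>i. set_lebesgue_integral lebesgue (F i) h)"
        using F union(1) by (intro lebesgue_integral_countable_add si) (auto simp: disjoint_family_on_def)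
      then show ?case
        using union by simp
    qed (simp add: set_lebesgue_integral_def)
  qed
  show "set_lebesgue_integral lebesgue A h = 0" if A: "A \<in> sets lebesgue" for A
  proof -
    \<comment> \<open>A Lebesgue set differs from a Borel set by a null set, which does not change
      the integral.\<close>
    obtain S N N' where SN: "A = S \<union> N" "N \<subseteq> N'" "N' \<in> null_sets lborel" "S \<in> sets lborel"
      by (rule sets_completionE[OF A])
    have "sym_diff A S \<subseteq> N'"
      using SN(1,2) by blast
    then have "sym_diff A S \<in> null_sets lebesgue"
      using completion.complete2 null_sets_completionI[OF SN(3)] by blast
    then have "set_lebesgue_integral lebesgue A h = set_lebesgue_integral lebesgue S h"
      using A SN(4) by (intro set_integral_null_delta int) auto
    then show ?thesis
      using borel[of S] SN(4) by simp
  qed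
qed

text \<open>On \<Omega> of infinite measure \<open>g\<close> may fail to be integrable, and bumps
  exist only for boxes whose closure lies in \<Omega>. So \<open>g\<close> is first cut off to one
  such box, where all box integrals vanish, and then \<Omega> is covered by countably many closed
  boxes.\<close>

lemma fundamental_lemma_calculus_of_variations:
  fixes g :: "'a::euclidean_space \<Rightarrow> real"
  assumes "open \<Omega>" and g: "g \<in> L2 \<Omega>"
    and orth: "\<And>\<psi>. \<psi> \<in> test_functions \<Omega> \<Longrightarrow> (LINT x|lebesgue_on \<Omega>. g x * \<psi> x) = 0"
  shows "AE x in lebesgue_on \<Omega>. g x = 0"
proof -
  have \<Omega>: "\<Omega> \<in> sets lebesgue" using assms(1) by auto
  note box = integral_box_eq_0[OF assms(1) g orth]
  have cbox: "AE x in lebesgue. x \<in> cbox p q \<longrightarrow> g x = 0" if pq: "cbox p q \<subseteq> \<Omega>" for p q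
  proof -
    define h where "h x = indicator (box p q) x * g x" for x
    have bsub: "box p q \<subseteq> \<Omega>" using pq box_subset_cbox by blast
    have heq: "indicator \<Omega> x * (g x * indicator (box c d) x) = indicator (box c d) x * g x"
      if "box c d \<subseteq> \<Omega>" for c d x
      using that by (auto simp: indicator_def)
    have ib: "integral\<^sup>L lebesgue (\<lambda>x. indicator (box c d) x * g x) = 0" if cd: "cbox c d \<subseteq> \<Omega>" for c d
      using box(2)[OF _ cd] \<Omega> heq[OF order_trans[OF box_subset_cbox cd]]
      by (simp add: integral_restrict_space)
    have "AE x in lebesgue. h x = 0"
    proof (rule AE_zero_if_box_integrals_zero)
      show "integrable lebesgue h"
        using box(1)[OF _ pq] \<Omega> heq[OF bsub] by (simp add: integrable_restrict_space h_def[abs_def])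
      show "integral\<^sup>L lebesgue h = 0"
        unfolding h_def[abs_def] by (rule ib[OF pq])
      show "set_lebesgue_integral lebesgue (box a b) h = 0" for a b
      proof -
        \<comment> \<open>The intersection of an arbitrary box with \<open>box p q\<close> is again
          a box, and its closed counterpart stays inside \<open>cbox p q\<close>, hence inside
          \<Omega>.\<close>
        obtain c d where cd: "box a b \<inter> box p q = box c d" "cbox a b \<inter> cbox p q = cbox c d"
          by (rule that[OF box_Int_box Int_interval])
        have "set_lebesgue_integral lebesgue (box a b) h = integral\<^sup>L lebesgue (\<lambda>x. indicator (box c d) x * g x)"
          unfolding set_lebesgue_integral_def h_def
          by (simp add: cd(1)[symmetric] indicator_inter_arith mult.assoc)
        also have "\<dots> = 0"
          using cd(2) pq by (intro ib) auto
        finally show ?thesis .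
      qed
    qed
    \<comment> \<open>The cut-off is by the open box; its boundary is a null set.\<close>
    moreover have "AE x in lebesgue. x \<notin> cbox p q - box p q"
      using negligible_frontier_interval[of p q] by (intro AE_not_in) (simp add: negligible_iff_null_sets)
    ultimately show ?thesis
      by eventually_elim (auto simp: h_def)
  qed
  obtain \<D> where D: "countable \<D>" "\<D> \<subseteq> Pow \<Omega>" "\<And>X. X \<in> \<D> \<Longrightarrow> \<exists>a b. X = cbox a b" "\<Union>\<D> = \<Omega>"
    using open_countable_Union_open_cbox[OF assms(1)] by metis
  have "AE x in lebesgue. \<forall>X\<in>\<D>. x \<in> X \<longrightarrow> g x = 0"
  proof (subst AE_ball_countable[OF D(1)], rule ballI)
    fix X assume X: "X \<in> \<D>"
    then obtain a b where "X = cbox a b" using D(3) by blast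
    then show "AE x in lebesgue. x \<in> X \<longrightarrow> g x = 0"
      using cbox[of a b] D(2) X by auto
  qed
  then have "AE x in lebesgue. x \<in> \<Omega> \<longrightarrow> g x = 0"
    using D(4) by (auto elim!: eventually_mono)
  then show ?thesis
    using \<Omega> by (subst AE_restrict_space_iff) auto
qed

section \<open>Weak gradients\<close>

lemma weak_gradient_spec:
  assumes "u \<in> H1 \<Omega>"
  shows "weak_gradient \<Omega> u \<in> L2 \<Omega>" "is_weak_gradient \<Omega> u (weak_gradient \<Omega> u)"
proof -
  have "\<exists>g. g \<in> L2 \<Omega> \<and> is_weak_gradient \<Omega> u g"
    using assms by (auto simp: H1_def)
  from someI_ex[OF this]
  show "weak_gradient \<Omega> u \<in> L2 \<Omega>" "is_weak_gradient \<Omega> u (weak_gradient \<Omega> u)"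
    by (simp_all add: weak_gradient_def)
qed

text \<open>Every component of \<open>g - h\<close> is orthogonal to all test functions, so the
  fundamental lemma applies componentwise. This makes the arbitrary choice in
  \<open>weak_gradient\<close> harmless up to null sets.\<close>

lemma weak_gradient_unique:
  fixes \<Omega> :: "'a::euclidean_space set"
  assumes "open \<Omega>" and gh: "g \<in> L2 \<Omega>" "h \<in> L2 \<Omega>"
    and wg: "is_weak_gradient \<Omega> u g" "is_weak_gradient \<Omega> u h"
  shows "AE x in lebesgue_on \<Omega>. g x = h x"
proof -
  have \<Omega>: "\<Omega> \<in> sets lebesgue" using assms(1) by auto
  have "AE x in lebesgue_on \<Omega>. inner (g x - h x) b = 0" if b: "b \<in> Basis" for b
  proof (rule fundamental_lemma_calculus_of_variations[OF assms(1) L2_component[OF L2_diff[OF gh]]])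
    fix \<psi> assume \<psi>: "\<psi> \<in> test_functions \<Omega>"
    have int: "integrable (lebesgue_on \<Omega>) (\<lambda>x. inner (f x) b * \<psi> x)" if "f \<in> L2 \<Omega>" for f :: "'a \<Rightarrow> 'a"
      using L2_inner_integrable[OF L2_component[OF that] test_functions_L2[OF \<Omega> \<psi>]] by simp
    have "(LINT x|lebesgue_on \<Omega>. inner (g x) b * \<psi> x) = (LINT x|lebesgue_on \<Omega>. inner (h x) b * \<psi> x)"
      using wg(1)[unfolded is_weak_gradient_def, rule_format, OF \<psi> b]
        wg(2)[unfolded is_weak_gradient_def, rule_format, OF \<psi> b] by linarith
    then show "(LINT x|lebesgue_on \<Omega>. inner (g x - h x) b * \<psi> x) = 0"
      using int[OF gh(1)] int[OF gh(2)] by (simp add: inner_diff_left left_diff_distrib)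
  qed
  then have "AE x in lebesgue_on \<Omega>. \<forall>b\<in>Basis. inner (g x - h x) b = 0"
    by (intro AE_finite_allI) auto
  then show ?thesis
    by eventually_elim (auto simp: inner_diff_left intro: euclidean_eqI)
qed

lemma is_weak_gradient_lincomb:
  fixes \<Omega> :: "'a::euclidean_space set"
  assumes \<Omega>: "\<Omega> \<in> sets lebesgue" and L2: "u \<in> L2 \<Omega>" "v \<in> L2 \<Omega>" "g \<in> L2 \<Omega>" "h \<in> L2 \<Omega>"
    and wg: "is_weak_gradient \<Omega> u g" "is_weak_gradient \<Omega> v h"
  shows "is_weak_gradient \<Omega> (\<lambda>x. a * u x + b * v x) (\<lambda>x. a *\<^sub>R g x + b *\<^sub>R h x)"
  unfolding is_weak_gradient_def
proof (intro ballI)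
  fix \<psi> and i :: 'a assume \<psi>: "\<psi> \<in> test_functions \<Omega>" and i: "i \<in> Basis"
  let ?D = "\<lambda>x. frechet_derivative \<psi> (at x) i"
  have int1: "integrable (lebesgue_on \<Omega>) (\<lambda>x. w x * ?D x)" if "w \<in> L2 \<Omega>" for w
    using L2_inner_integrable[OF that test_functions_derivative_L2[OF \<Omega> \<psi> i]] by simp
  have int2: "integrable (lebesgue_on \<Omega>) (\<lambda>x. inner (f x) i * \<psi> x)" if "f \<in> L2 \<Omega>" for f :: "'a \<Rightarrow> 'a"
    using L2_inner_integrable[OF L2_component[OF that] test_functions_L2[OF \<Omega> \<psi>]] by simp
  have "(LINT x|lebesgue_on \<Omega>. (a * u x + b * v x) * ?D x)
      = a * (LINT x|lebesgue_on \<Omega>. u x * ?D x) + b * (LINT x|lebesgue_on \<Omega>. v x * ?D x)"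
    using int1[OF L2(1)] int1[OF L2(2)] by (simp add: distrib_right mult.assoc)
  also have "\<dots> = - (a * (LINT x|lebesgue_on \<Omega>. inner (g x) i * \<psi> x)
      + b * (LINT x|lebesgue_on \<Omega>. inner (h x) i * \<psi> x))"
    using wg \<psi> i by (simp add: is_weak_gradient_def)
  also have "\<dots> = - (LINT x|lebesgue_on \<Omega>. inner (a *\<^sub>R g x + b *\<^sub>R h x) i * \<psi> x)"
    using int2[OF L2(3)] int2[OF L2(4)] by (simp add: inner_add_left distrib_right mult.assoc)
  finally show "(LINT x|lebesgue_on \<Omega>. (a * u x + b * v x) * ?D x)
      = - (LINT x|lebesgue_on \<Omega>. inner (a *\<^sub>R g x + b *\<^sub>R h x) i * \<psi> x)" .
qed

lemma H1_L2: "u \<in> H1 \<Omega> \<Longrightarrow> u \<in> L2 \<Omega>"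
  by (simp add: H1_def)

text \<open>Chosen representatives need not combine linearly at every point. Both sides of the
  second claim are weak gradients of the same function, so uniqueness identifies them almost
  everywhere.\<close>

lemma H1_lincomb:
  assumes "open \<Omega>" "u \<in> H1 \<Omega>" "v \<in> H1 \<Omega>"
  shows "(\<lambda>x. a * u x + b * v x) \<in> H1 \<Omega>"
    and "AE x in lebesgue_on \<Omega>. weak_gradient \<Omega> (\<lambda>x. a * u x + b * v x) x
           = a *\<^sub>R weak_gradient \<Omega> u x + b *\<^sub>R weak_gradient \<Omega> v x"
proof -
  have \<Omega>: "\<Omega> \<in> sets lebesgue" using assms(1) by auto
  note u = H1_L2[OF assms(2)] weak_gradient_spec[OF assms(2)]
  note v = H1_L2[OF assms(3)] weak_gradient_spec[OF assms(3)]
  have g: "(\<lambda>x. a *\<^sub>R weak_gradient \<Omega> u x + b *\<^sub>R weak_gradient \<Omega> v x) \<in> L2 \<Omega>"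
    by (intro L2_add L2_scaleR u v)
  have w: "is_weak_gradient \<Omega> (\<lambda>x. a * u x + b * v x)
      (\<lambda>x. a *\<^sub>R weak_gradient \<Omega> u x + b *\<^sub>R weak_gradient \<Omega> v x)"
    by (intro is_weak_gradient_lincomb \<Omega> u v)
  have "(\<lambda>x. a * u x + b * v x) \<in> L2 \<Omega>"
    by (intro L2_add L2_cmult u v)
  with g w show H: "(\<lambda>x. a * u x + b * v x) \<in> H1 \<Omega>"
    by (auto simp: H1_def)
  show "AE x in lebesgue_on \<Omega>. weak_gradient \<Omega> (\<lambda>x. a * u x + b * v x) x
           = a *\<^sub>R weak_gradient \<Omega> u x + b *\<^sub>R weak_gradient \<Omega> v x"
    by (rule weak_gradient_unique[OF assms(1) weak_gradient_spec(1)[OF H] g weak_gradient_spec(2)[OF H] w])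
qed

lemma is_weak_gradient_cong_AE:
  assumes \<Omega>: "\<Omega> \<in> sets lebesgue" and L2: "u \<in> L2 \<Omega>" "u' \<in> L2 \<Omega>"
    and ae: "AE x in lebesgue_on \<Omega>. u x = u' x"
  shows "is_weak_gradient \<Omega> u = is_weak_gradient \<Omega> u'"
proof (intro ext)
  fix g
  have "(LINT x|lebesgue_on \<Omega>. u x * frechet_derivative \<psi> (at x) b)
      = (LINT x|lebesgue_on \<Omega>. u' x * frechet_derivative \<psi> (at x) b)"
    if "\<psi> \<in> test_functions \<Omega>" "b \<in> Basis" for \<psi> b
  proof (rule integral_cong_AE)
    show "AE x in lebesgue_on \<Omega>. u x * frechet_derivative \<psi> (at x) b = u' x * frechet_derivative \<psi> (at x) b"
      using ae by eventually_elim simp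
  qed (intro borel_measurable_times L2_measurable L2 test_functions_derivative_L2 \<Omega> that)+
  then show "is_weak_gradient \<Omega> u g = is_weak_gradient \<Omega> u' g"
    by (auto simp: is_weak_gradient_def)
qed

text \<open>The equality is exact: both functions have the same set of weak gradients, so the choice
  operator returns the same one.\<close>

lemma weak_gradient_cong_AE:
  assumes "\<Omega> \<in> sets lebesgue" "u \<in> L2 \<Omega>" "u' \<in> L2 \<Omega>" "AE x in lebesgue_on \<Omega>. u x = u' x"
  shows "weak_gradient \<Omega> u = weak_gradient \<Omega> u'"
  using is_weak_gradient_cong_AE[OF assms] by (simp add: weak_gradient_def[abs_def])

section \<open>Linear structure of \<open>H10\<close>\<close>

lemma H10_H1: "u \<in> H10 \<Omega> \<Longrightarrow> u \<in> H1 \<Omega>"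
  by (simp add: H10_def)

text \<open>\<open>L2_span\<close> contains all square integrable functions that agree almost
  everywhere with a linear combination, so placing it in \<open>H10 \<Omega>\<close> requires this
  invariance. The approximating test functions stay the same.\<close>

lemma H10_cong_AE:
  assumes \<Omega>: "\<Omega> \<in> sets lebesgue" and u: "u \<in> H10 \<Omega>" and u': "u' \<in> L2 \<Omega>"
    and ae: "AE x in lebesgue_on \<Omega>. u x = u' x"
  shows "u' \<in> H10 \<Omega>"
proof -
  have uL: "u \<in> L2 \<Omega>" using u by (intro H1_L2 H10_H1)
  note wg = weak_gradient_cong_AE[OF \<Omega> uL u' ae]
  have "u' \<in> H1 \<Omega>"
    using H10_H1[OF u] u' is_weak_gradient_cong_AE[OF \<Omega> uL u' ae] by (auto simp: H1_def)
  moreover obtain \<psi> where \<psi>: "\<forall>n. \<psi> n \<in> test_functions \<Omega>"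
      "(\<lambda>n. l2_norm \<Omega> (\<lambda>x. u x - \<psi> n x)) \<longlonglongrightarrow> 0"
      "(\<lambda>n. l2_norm \<Omega> (\<lambda>x. weak_gradient \<Omega> u x - gradient (\<psi> n) x)) \<longlonglongrightarrow> 0"
    using u unfolding H10_def by blast
  moreover have "l2_norm \<Omega> (\<lambda>x. u x - \<psi> n x) = l2_norm \<Omega> (\<lambda>x. u' x - \<psi> n x)" for n
  proof (rule l2_norm_cong_AE)
    show "AE x in lebesgue_on \<Omega>. u x - \<psi> n x = u' x - \<psi> n x"
      using ae by eventually_elim simp
  qed (use \<psi>(1) in \<open>auto intro: L2_diff uL u' test_functions_L2 \<Omega>\<close>)
  ultimately show ?thesis
    unfolding H10_def by (auto simp: wg)
qed

lemma zero_H10: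
  fixes \<Omega> :: "'a::euclidean_space set"
  assumes "open \<Omega>"
  shows "(\<lambda>x. 0) \<in> H10 \<Omega>"
proof -
  have w: "is_weak_gradient \<Omega> (\<lambda>x. 0) (\<lambda>x. 0)"
    by (simp add: is_weak_gradient_def)
  then have H1: "(\<lambda>x. 0) \<in> H1 \<Omega>"
    unfolding H1_def by (intro CollectI conjI L2_zero bexI[OF _ L2_zero])
  have "AE x in lebesgue_on \<Omega>. weak_gradient \<Omega> (\<lambda>x. 0) x = 0"
    by (rule weak_gradient_unique[OF assms weak_gradient_spec(1)[OF H1] L2_zero weak_gradient_spec(2)[OF H1] w])
  from l2_norm_cong_AE[OF this weak_gradient_spec(1)[OF H1] L2_zero]
  have "l2_norm \<Omega> (weak_gradient \<Omega> (\<lambda>x. 0)) = 0"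
    by (simp add: l2_norm_def l2_inner_def)
  moreover have "(\<lambda>x::'a. 0::real) \<in> test_functions \<Omega>"
    using Ck_const[of _ 0] by (auto simp: test_functions_def)
  moreover have "gradient (\<lambda>x::'a. 0) = (\<lambda>x. 0)"
    by (simp add: gradient_def[abs_def])
  moreover have "l2_norm \<Omega> (\<lambda>x. 0::real) = 0"
    by (simp add: l2_norm_def l2_inner_def)
  ultimately show ?thesis
    using H1 unfolding H10_def by (auto intro!: exI[of _ "\<lambda>n x. 0"])
qed

lemma l2_norm_lincomb_le:
  assumes "f \<in> L2 \<Omega>" "g \<in> L2 \<Omega>"
  shows "l2_norm \<Omega> (\<lambda>x. a *\<^sub>R f x + b *\<^sub>R g x) \<le> \<bar>a\<bar> * l2_norm \<Omega> f + \<bar>b\<bar> * l2_norm \<Omega> g"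
  using l2_norm_triangle[OF L2_scaleR[OF assms(1), of a] L2_scaleR[OF assms(2), of b]]
  by (simp add: l2_norm_scaleR)

text \<open>The combined approximating sequences work: the triangle inequality bounds both errors,
  for the gradients after passing almost everywhere to the combination of the chosen weak
  gradients.\<close>

lemma H10_lincomb:
  assumes "open \<Omega>" "u \<in> H10 \<Omega>" "v \<in> H10 \<Omega>"
  shows "(\<lambda>x. a * u x + b * v x) \<in> H10 \<Omega>"
proof -
  have \<Omega>: "\<Omega> \<in> sets lebesgue" using assms(1) by auto
  note uv = H10_H1[OF assms(2)] H10_H1[OF assms(3)]
  let ?w = "\<lambda>x. a * u x + b * v x"
  note H1 = H1_lincomb(1)[OF assms(1) uv, of a b] and ae = H1_lincomb(2)[OF assms(1) uv, of a b]
  obtain \<psi> where \<psi>: "\<And>n. \<psi> n \<in> test_functions \<Omega>"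
      "(\<lambda>n. l2_norm \<Omega> (\<lambda>x. u x - \<psi> n x)) \<longlonglongrightarrow> 0"
      "(\<lambda>n. l2_norm \<Omega> (\<lambda>x. weak_gradient \<Omega> u x - gradient (\<psi> n) x)) \<longlonglongrightarrow> 0"
    using assms(2) unfolding H10_def by blast
  obtain \<theta> where \<theta>: "\<And>n. \<theta> n \<in> test_functions \<Omega>"
      "(\<lambda>n. l2_norm \<Omega> (\<lambda>x. v x - \<theta> n x)) \<longlonglongrightarrow> 0"
      "(\<lambda>n. l2_norm \<Omega> (\<lambda>x. weak_gradient \<Omega> v x - gradient (\<theta> n) x)) \<longlonglongrightarrow> 0"
    using assms(3) unfolding H10_def by blast
  define \<xi> where "\<xi> n x = a * \<psi> n x + b * \<theta> n x" for n x
  have \<xi>: "\<xi> n \<in> test_functions \<Omega>" for n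
    unfolding \<xi>_def[abs_def] by (intro test_functions_add test_functions_cmult \<psi> \<theta>)
  have g\<xi>: "gradient (\<xi> n) x = a *\<^sub>R gradient (\<psi> n) x + b *\<^sub>R gradient (\<theta> n) x" for n x
    unfolding \<xi>_def[abs_def]
    using gradient_add[OF test_functions_cmult[OF \<psi>(1)[of n], of a] test_functions_cmult[OF \<theta>(1)[of n], of b], of x]
    by (simp add: gradient_cmult[OF \<psi>(1)] gradient_cmult[OF \<theta>(1)])
  have "(\<lambda>n. l2_norm \<Omega> (\<lambda>x. ?w x - \<xi> n x)) \<longlonglongrightarrow> 0"
  proof (rule tendsto_sandwich[OF always_eventually always_eventually tendsto_const])
    show "\<forall>n. 0 \<le> l2_norm \<Omega> (\<lambda>x. ?w x - \<xi> n x)"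
      by (simp add: l2_norm_ge_0)
    show "\<forall>n. l2_norm \<Omega> (\<lambda>x. ?w x - \<xi> n x)
        \<le> \<bar>a\<bar> * l2_norm \<Omega> (\<lambda>x. u x - \<psi> n x) + \<bar>b\<bar> * l2_norm \<Omega> (\<lambda>x. v x - \<theta> n x)"
    proof
      fix n
      show "l2_norm \<Omega> (\<lambda>x. ?w x - \<xi> n x)
        \<le> \<bar>a\<bar> * l2_norm \<Omega> (\<lambda>x. u x - \<psi> n x) + \<bar>b\<bar> * l2_norm \<Omega> (\<lambda>x. v x - \<theta> n x)"
        using l2_norm_lincomb_le[OF L2_diff[OF H1_L2[OF uv(1)] test_functions_L2[OF \<Omega> \<psi>(1)]]
              L2_diff[OF H1_L2[OF uv(2)] test_functions_L2[OF \<Omega> \<theta>(1)]], of a n b n]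
        by (simp add: \<xi>_def algebra_simps)
    qed
    show "(\<lambda>n. \<bar>a\<bar> * l2_norm \<Omega> (\<lambda>x. u x - \<psi> n x) + \<bar>b\<bar> * l2_norm \<Omega> (\<lambda>x. v x - \<theta> n x)) \<longlonglongrightarrow> 0"
      using tendsto_add[OF tendsto_mult_left[OF \<psi>(2), of "\<bar>a\<bar>"] tendsto_mult_left[OF \<theta>(2), of "\<bar>b\<bar>"]] by simp
  qed
  moreover have "(\<lambda>n. l2_norm \<Omega> (\<lambda>x. weak_gradient \<Omega> ?w x - gradient (\<xi> n) x)) \<longlonglongrightarrow> 0"
  proof (rule tendsto_sandwich[OF always_eventually always_eventually tendsto_const])
    show "\<forall>n. 0 \<le> l2_norm \<Omega> (\<lambda>x. weak_gradient \<Omega> ?w x - gradient (\<xi> n) x)"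
      by (simp add: l2_norm_ge_0)
    let ?gu = "\<lambda>n x. weak_gradient \<Omega> u x - gradient (\<psi> n) x"
    let ?gv = "\<lambda>n x. weak_gradient \<Omega> v x - gradient (\<theta> n) x"
    show "\<forall>n. l2_norm \<Omega> (\<lambda>x. weak_gradient \<Omega> ?w x - gradient (\<xi> n) x)
        \<le> \<bar>a\<bar> * l2_norm \<Omega> (?gu n) + \<bar>b\<bar> * l2_norm \<Omega> (?gv n)"
    proof
      fix n
      have L: "?gu n \<in> L2 \<Omega>" "?gv n \<in> L2 \<Omega>"
        by (intro L2_diff weak_gradient_spec uv gradient_L2 \<Omega> \<psi> \<theta>)+
      have "l2_norm \<Omega> (\<lambda>x. weak_gradient \<Omega> ?w x - gradient (\<xi> n) x)
          = l2_norm \<Omega> (\<lambda>x. a *\<^sub>R ?gu n x + b *\<^sub>R ?gv n x)"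
      proof (rule l2_norm_cong_AE)
        show "AE x in lebesgue_on \<Omega>. weak_gradient \<Omega> ?w x - gradient (\<xi> n) x = a *\<^sub>R ?gu n x + b *\<^sub>R ?gv n x"
          using ae by eventually_elim (simp add: g\<xi> algebra_simps)
        show "(\<lambda>x. weak_gradient \<Omega> ?w x - gradient (\<xi> n) x) \<in> L2 \<Omega>"
          by (intro L2_diff weak_gradient_spec H1 gradient_L2 \<Omega> \<xi>)
      qed (intro L2_add L2_scaleR L)
      then show "l2_norm \<Omega> (\<lambda>x. weak_gradient \<Omega> ?w x - gradient (\<xi> n) x)
          \<le> \<bar>a\<bar> * l2_norm \<Omega> (?gu n) + \<bar>b\<bar> * l2_norm \<Omega> (?gv n)"
        using l2_norm_lincomb_le[OF L, of a b] by simp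
    qed
    show "(\<lambda>n. \<bar>a\<bar> * l2_norm \<Omega> (?gu n) + \<bar>b\<bar> * l2_norm \<Omega> (?gv n)) \<longlonglongrightarrow> 0"
      using tendsto_add[OF tendsto_mult_left[OF \<psi>(3), of "\<bar>a\<bar>"] tendsto_mult_left[OF \<theta>(3), of "\<bar>b\<bar>"]] by simp
  qed
  ultimately show ?thesis
    unfolding H10_def using H1 \<xi> by blast
qed

lemma H10_sum:
  fixes n :: nat
  assumes "open \<Omega>" "\<And>k. k < n \<Longrightarrow> w k \<in> H10 \<Omega>"
  shows "(\<lambda>x. \<Sum>k<n. c k * w k x) \<in> H10 \<Omega>"
  using assms(2)
proof (induction n)
  case 0
  show ?case using zero_H10[OF assms(1)] by simp
next
  case (Suc n)
  then show ?case
    using H10_lincomb[OF assms(1), of "\<lambda>x. \<Sum>k<n. c k * w k x" "w n" 1 "c n"] by simp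
qed

lemma H10_weak_gradient_sum:
  fixes n :: nat
  assumes "open \<Omega>" "\<And>k. k < n \<Longrightarrow> w k \<in> H10 \<Omega>"
  shows "AE x in lebesgue_on \<Omega>. weak_gradient \<Omega> (\<lambda>x. \<Sum>k<n. c k * w k x) x
           = (\<Sum>k<n. c k *\<^sub>R weak_gradient \<Omega> (w k) x)"
  using assms(2)
proof (induction n)
  case 0
  note H1 = H10_H1[OF zero_H10[OF assms(1)]]
  \<comment> \<open>Linearity with both coefficients zero gives the weak gradient of the zero
    function.\<close>
  have "AE x in lebesgue_on \<Omega>. weak_gradient \<Omega> (\<lambda>x. 0) x = 0"
    using H1_lincomb(2)[OF assms(1) H1 H1, of 0 0] by simp
  then show ?case by simp
next
  case (Suc n)
  have "(\<lambda>x. \<Sum>k<n. c k * w k x) \<in> H1 \<Omega>" "w n \<in> H1 \<Omega>"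
    using Suc.prems by (auto intro!: H10_H1 H10_sum assms(1))
  from H1_lincomb(2)[OF assms(1) this, of 1 "c n"]
  have "AE x in lebesgue_on \<Omega>. weak_gradient \<Omega> (\<lambda>x. \<Sum>k<Suc n. c k * w k x) x
      = weak_gradient \<Omega> (\<lambda>x. \<Sum>k<n. c k * w k x) x + c n *\<^sub>R weak_gradient \<Omega> (w n) x"
    by simp
  moreover have "AE x in lebesgue_on \<Omega>. weak_gradient \<Omega> (\<lambda>x. \<Sum>k<n. c k * w k x) x
      = (\<Sum>k<n. c k *\<^sub>R weak_gradient \<Omega> (w k) x)"
    using Suc by simp
  ultimately show ?case
    by eventually_elim simp
qed

section \<open>The matrix norm and the inverse estimate\<close>

lemma vec_norm2_L2_set: "vec_norm2 x = L2_set (vec_index x) {0..<dim_vec x}"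
  by (simp add: vec_norm2_def scalar_prod_def L2_set_def power2_eq_square)

lemma scalar_prod_le_vec_norm2:
  assumes "dim_vec x = dim_vec y"
  shows "scalar_prod x y \<le> vec_norm2 x * vec_norm2 y"
proof -
  have "scalar_prod x y \<le> (\<Sum>i\<in>{0..<dim_vec y}. \<bar>vec_index x i\<bar> * \<bar>vec_index y i\<bar>)"
    unfolding scalar_prod_def by (intro sum_mono) (metis abs_ge_self abs_mult)
  also have "\<dots> \<le> vec_norm2 x * vec_norm2 y"
    unfolding vec_norm2_L2_set assms by (rule L2_set_mult_ineq)
  finally show ?thesis .
qed

lemma abs_vec_index_le_vec_norm2: "i < dim_vec x \<Longrightarrow> \<bar>vec_index x i\<bar> \<le> vec_norm2 x"
  unfolding vec_norm2_L2_set using member_le_L2_set[of "{0..<dim_vec x}" i "\<lambda>i. \<bar>vec_index x i\<bar>"]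
  by (simp add: L2_set_def)

lemma vec_norm2_smult: "vec_norm2 (smult_vec c x) = \<bar>c\<bar> * vec_norm2 x"
proof -
  have "scalar_prod (smult_vec c x) (smult_vec c x) = c\<^sup>2 * scalar_prod x x"
    by (simp add: power2_eq_square mult.assoc)
  then show ?thesis
    by (simp add: vec_norm2_def real_sqrt_mult)
qed

text \<open>A real supremum is informative only for a set bounded above. In the unit ball every
  coordinate of \<open>x\<close> is at most 1 in absolute value, so absolute row sums bound the
  coordinates of \<open>A *\<^sub>v x\<close>.\<close>

lemma bdd_above_mat_norm2:
  "bdd_above ((\<lambda>x. vec_norm2 (A *\<^sub>v x)) ` {x \<in> carrier_vec (dim_col A). vec_norm2 x \<le> 1})"
proof (rule bdd_aboveI2)
  fix x assume x: "x \<in> {x \<in> carrier_vec (dim_col A). vec_norm2 x \<le> 1}"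
  have "\<bar>vec_index (A *\<^sub>v x) i\<bar> \<le> (\<Sum>j\<in>{0..<dim_col A}. \<bar>A $$ (i, j)\<bar>)" if i: "i < dim_row A" for i
  proof -
    have "\<bar>vec_index (A *\<^sub>v x) i\<bar> = \<bar>\<Sum>j\<in>{0..<dim_col A}. A $$ (i, j) * vec_index x j\<bar>"
      using i x by (auto simp: scalar_prod_def intro!: arg_cong[where f = abs] sum.cong)
    also have "\<dots> \<le> (\<Sum>j\<in>{0..<dim_col A}. \<bar>A $$ (i, j) * vec_index x j\<bar>)"
      by (rule sum_abs)
    also have "\<dots> \<le> (\<Sum>j\<in>{0..<dim_col A}. \<bar>A $$ (i, j)\<bar>)"
    proof (rule sum_mono)
      fix j assume "j \<in> {0..<dim_col A}"
      then have "\<bar>vec_index x j\<bar> \<le> 1"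
        using x abs_vec_index_le_vec_norm2[of j x] by auto
      then show "\<bar>A $$ (i, j) * vec_index x j\<bar> \<le> \<bar>A $$ (i, j)\<bar>"
        by (simp add: abs_mult mult_left_le)
    qed
    finally show ?thesis .
  qed
  then have "L2_set (\<lambda>i. \<bar>vec_index (A *\<^sub>v x) i\<bar>) {0..<dim_row A}
      \<le> L2_set (\<lambda>i. \<Sum>j\<in>{0..<dim_col A}. \<bar>A $$ (i, j)\<bar>) {0..<dim_row A}"
    by (intro L2_set_mono) auto
  then show "vec_norm2 (A *\<^sub>v x) \<le> L2_set (\<lambda>i. \<Sum>j\<in>{0..<dim_col A}. \<bar>A $$ (i, j)\<bar>) {0..<dim_row A}"
    by (simp add: vec_norm2_L2_set L2_set_def)
qed

lemma vec_norm2_mult_mat_vec_le: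
  assumes x: "x \<in> carrier_vec (dim_col A)"
  shows "vec_norm2 (A *\<^sub>v x) \<le> mat_norm2 A * vec_norm2 x"
proof (cases "vec_norm2 x = 0")
  case True
  then have "vec_index x j = 0" if "j < dim_col A" for j
    using abs_vec_index_le_vec_norm2[of j x] that x by auto
  then have "A *\<^sub>v x = 0\<^sub>v (dim_row A)"
    using x by (intro eq_vecI) (auto simp: scalar_prod_def intro!: sum.neutral)
  then show ?thesis
    using True by (simp add: vec_norm2_def)
next
  case False
  moreover have "vec_norm2 x \<ge> 0"
    by (simp add: vec_norm2_L2_set)
  ultimately have pos: "vec_norm2 x > 0" by simp
  let ?y = "smult_vec (1 / vec_norm2 x) x"
  have "?y \<in> carrier_vec (dim_col A)" "vec_norm2 ?y \<le> 1"
    using x pos by (auto simp: vec_norm2_smult)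
  then have "vec_norm2 (A *\<^sub>v ?y) \<le> mat_norm2 A"
    unfolding mat_norm2_def by (intro cSUP_upper bdd_above_mat_norm2) auto
  moreover have "A *\<^sub>v ?y = smult_vec (1 / vec_norm2 x) (A *\<^sub>v x)"
    using x by (intro mult_mat_vec) auto
  ultimately show ?thesis
    using pos by (simp add: vec_norm2_smult field_simps)
qed

lemma mat_norm2_ge_0: "0 \<le> mat_norm2 A"
proof -
  have "vec_norm2 (A *\<^sub>v 0\<^sub>v (dim_col A)) \<le> mat_norm2 A"
    unfolding mat_norm2_def by (intro cSUP_upper bdd_above_mat_norm2) (simp add: vec_norm2_def)
  then show ?thesis
    by (rule order_trans[rotated]) (simp add: vec_norm2_L2_set)
qed

text \<open>For the stiffness matrix the left side is the squared norm of the gradient of a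
  combination of POD modes with coefficients \<open>c\<close>.\<close>

lemma quadratic_form_le_mat_norm2:
  "(\<Sum>i<r. \<Sum>j<r. c i * c j * S (i, j)) \<le> mat_norm2 (mat r r S) * (\<Sum>i<r. (c i)\<^sup>2)"
proof -
  let ?A = "mat r r S" and ?x = "vec r c"
  have n: "(vec_norm2 ?x)\<^sup>2 = (\<Sum>i<r. (c i)\<^sup>2)"
    by (simp add: vec_norm2_L2_set L2_set_def sum_nonneg atLeast0LessThan)
  have "(\<Sum>i<r. \<Sum>j<r. c i * c j * S (i, j)) = scalar_prod ?x (?A *\<^sub>v ?x)"
    by (simp add: scalar_prod_def atLeast0LessThan sum_distrib_left mult_ac)
  also have "\<dots> \<le> vec_norm2 ?x * vec_norm2 (?A *\<^sub>v ?x)"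
    by (rule scalar_prod_le_vec_norm2) simp
  also have "\<dots> \<le> vec_norm2 ?x * (mat_norm2 ?A * vec_norm2 ?x)"
    by (intro mult_left_mono vec_norm2_mult_mat_vec_le) (auto simp: vec_norm2_L2_set)
  also have "\<dots> = mat_norm2 ?A * (\<Sum>i<r. (c i)\<^sup>2)"
    unfolding n[symmetric] by (simp add: power2_eq_square)
  finally show ?thesis .
qed

section \<open>Derivative of a Euclidean norm on a closed interval\<close>

lemma has_real_derivative_unique_Icc:
  fixes f :: "real \<Rightarrow> real"
  assumes "a < b" "t \<in> {a..b}"
    and "(f has_real_derivative D) (at t within {a..b})" "(f has_real_derivative E) (at t within {a..b})"
  shows "D = E"
proof -
  \<comment> \<open>As \<open>a < b\<close>, end points are limit points too, so one-sided
    derivatives are unique as well.\<close>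
  have "at t within {a..b} \<noteq> bot"
    using assms(1,2) by (simp add: trivial_limit_within islimpt_Icc)
  then show ?thesis
    using assms(3,4) unfolding has_field_derivative_iff by (rule tendsto_unique)
qed

text \<open>At a zero of the norm the one-sided derivative at an end point need not vanish; there the
  square of the difference quotient of the norm tends to \<open>\<Sum>k<r. (\<beta> k)\<^sup>2\<close>.\<close>

lemma euclidean_norm_derivative:
  fixes \<alpha> :: "nat \<Rightarrow> real \<Rightarrow> real" and \<beta> :: "nat \<Rightarrow> real" and r :: nat
  defines "n \<equiv> (\<lambda>y. sqrt (\<Sum>k<r. (\<alpha> k y)\<^sup>2))"
  assumes "a < b" and t: "t \<in> {a..b}"
    and \<alpha>: "\<And>k. k < r \<Longrightarrow> (\<alpha> k has_real_derivative \<beta> k) (at t within {a..b})"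
    and B: "B \<ge> 0" "(\<Sum>k<r. \<alpha> k t * \<beta> k) \<le> B * n t"
      "n t = 0 \<Longrightarrow> (\<Sum>k<r. (\<beta> k)\<^sup>2) \<le> B * sqrt (\<Sum>k<r. (\<beta> k)\<^sup>2)"
  shows "n t \<noteq> 0 \<Longrightarrow> n differentiable (at t within {a..b})"
    and "(n has_real_derivative D) (at t within {a..b}) \<Longrightarrow> D \<le> B"
proof -
  let ?E = "(\<Sum>k<r. \<alpha> k t * \<beta> k) / n t"
  have pos: "n t > 0" if "n t \<noteq> 0"
    using that by (simp add: n_def sum_nonneg less_le)
  have der: "(n has_real_derivative ?E) (at t within {a..b})" if "n t \<noteq> 0"
  proof -
    have s: "((\<lambda>y. \<Sum>k<r. (\<alpha> k y)\<^sup>2) has_real_derivative (\<Sum>k<r. 2 * (\<alpha> k t * \<beta> k))) (at t within {a..b})"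
      by (rule DERIV_sum) (auto intro!: derivative_eq_intros \<alpha>)
    have "(\<Sum>k<r. (\<alpha> k t)\<^sup>2) > 0"
      using pos[OF that] by (simp add: n_def)
    from DERIV_chain2[OF DERIV_real_sqrt[OF this] s] show ?thesis
      unfolding sum_distrib_left[symmetric] by (simp add: n_def field_simps)
  qed
  show "n differentiable (at t within {a..b})" if "n t \<noteq> 0"
    using der[OF that] by (auto simp: real_differentiable_def)
  show "D \<le> B" if D: "(n has_real_derivative D) (at t within {a..b})"
  proof (cases "n t = 0")
    case False
    then have "D = ?E"
      using has_real_derivative_unique_Icc[OF assms(2) t D der] by blast
    then show ?thesis
      using B(2) pos[OF False] by (simp add: divide_le_eq)
  next
    case True
    have "(\<Sum>k<r. (\<alpha> k t)\<^sup>2) = 0"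
      using True by (simp add: n_def)
    then have \<alpha>0: "\<alpha> k t = 0" if "k < r" for k
      using that by (simp add: sum_nonneg_eq_0_iff)
    have "((\<lambda>y. ((n y - n t) / (y - t))\<^sup>2) \<longlongrightarrow> D\<^sup>2) (at t within {a..b})"
      using D unfolding has_field_derivative_iff by (rule tendsto_power)
    \<comment> \<open>Squaring removes the root: \<open>n t\<close> and all coordinates at
      \<open>t\<close> are zero.\<close>
    moreover have "((n y - n t) / (y - t))\<^sup>2 = (\<Sum>k<r. ((\<alpha> k y - \<alpha> k t) / (y - t))\<^sup>2)" for y
      using \<alpha>0 True by (simp add: n_def power_divide sum_nonneg sum_divide_distrib)
    ultimately have "((\<lambda>y. \<Sum>k<r. ((\<alpha> k y - \<alpha> k t) / (y - t))\<^sup>2) \<longlongrightarrow> D\<^sup>2) (at t within {a..b})"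
      by simp
    moreover have "((\<lambda>y. \<Sum>k<r. ((\<alpha> k y - \<alpha> k t) / (y - t))\<^sup>2) \<longlongrightarrow> (\<Sum>k<r. (\<beta> k)\<^sup>2)) (at t within {a..b})"
      using \<alpha> unfolding has_field_derivative_iff by (intro tendsto_sum tendsto_power) auto
    moreover have "at t within {a..b} \<noteq> bot"
      using assms(2) t by (simp add: trivial_limit_within islimpt_Icc)
    ultimately have D2: "D\<^sup>2 = (\<Sum>k<r. (\<beta> k)\<^sup>2)"
      using tendsto_unique by blast
    \<comment> \<open>Here \<open>sqrt (D\<^sup>2)\<close> is \<bar>D\<bar>, so the assumption on
      \<beta> becomes an inequality from which a nonzero factor \<bar>D\<bar> cancels.\<close>
    then have "D\<^sup>2 \<le> B * \<bar>D\<bar>"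
      using B(3)[OF True] by (metis real_sqrt_abs)
    then have "\<bar>D\<bar> * \<bar>D\<bar> \<le> B * \<bar>D\<bar>"
      by (simp add: power2_eq_square)
    then have "\<bar>D\<bar> \<le> B" if "D \<noteq> 0"
      using that by (intro mult_right_le_imp_le[of "\<bar>D\<bar>" "\<bar>D\<bar>"]) auto
    then show ?thesis
      using B(1) by (cases "D = 0") auto
  qed
qed

section \<open>Expansion in orthonormal modes and the inverse estimate\<close>

lemma L2_orthonormal_expansion:
  assumes on: "L2_orthonormal \<Omega> r \<phi>" and w: "w \<in> L2_span \<Omega> r \<phi>"
  shows "AE x in lebesgue_on \<Omega>. w x = (\<Sum>k<r. l2_inner \<Omega> w (\<phi> k) * \<phi> k x)"
proof -
  have \<phi>: "\<phi> k \<in> L2 \<Omega>" if "k < r" for k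
    using on that by (simp add: L2_orthonormal_def)
  obtain c where wL: "w \<in> L2 \<Omega>" and c: "AE x in lebesgue_on \<Omega>. w x = (\<Sum>k<r. c k * \<phi> k x)"
    using w by (auto simp: L2_span_def)
  \<comment> \<open>Testing the representation with a mode identifies its coefficient.\<close>
  have "l2_inner \<Omega> w (\<phi> j) = c j" if j: "j < r" for j
  proof -
    have "l2_inner \<Omega> w (\<phi> j) = l2_inner \<Omega> (\<lambda>x. \<Sum>k<r. c k * \<phi> k x) (\<phi> j)"
      by (rule l2_inner_cong_AE[OF c]) (auto intro!: wL L2_sum L2_cmult \<phi> j)
    also have "\<dots> = (\<Sum>k<r. c k * l2_inner \<Omega> (\<phi> k) (\<phi> j))"
      using l2_inner_sum_left[of "{..<r}" \<phi> \<Omega> "\<phi> j" c] \<phi> j by simp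
    also have "\<dots> = (\<Sum>k<r. if k = j then c k else 0)"
      using on j by (intro sum.cong) (auto simp: L2_orthonormal_def)
    finally show ?thesis using j by simp
  qed
  then show ?thesis
    using c by simp
qed

text \<open>Turns the norm of a POD function into the Euclidean norm of its coordinates, the form
  treated by \<open>euclidean_norm_derivative\<close>.\<close>

lemma L2_orthonormal_Parseval:
  assumes on: "L2_orthonormal \<Omega> r \<phi>" and w: "w \<in> L2_span \<Omega> r \<phi>"
  shows "l2_norm \<Omega> w = sqrt (\<Sum>k<r. (l2_inner \<Omega> w (\<phi> k))\<^sup>2)"
proof -
  have \<phi>: "\<phi> k \<in> L2 \<Omega>" if "k < r" for k
    using on that by (simp add: L2_orthonormal_def)
  have wL: "w \<in> L2 \<Omega>" using w by (simp add: L2_span_def)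
  have "l2_inner \<Omega> w w = l2_inner \<Omega> w (\<lambda>x. \<Sum>k<r. l2_inner \<Omega> w (\<phi> k) * \<phi> k x)"
    by (rule l2_inner_cong_AE[OF _ L2_orthonormal_expansion[OF on w]]) (auto intro!: wL L2_sum L2_cmult \<phi>)
  also have "\<dots> = (\<Sum>k<r. (l2_inner \<Omega> w (\<phi> k))\<^sup>2)"
    using l2_inner_sum_right[of "{..<r}" \<phi> \<Omega> w "\<lambda>k. l2_inner \<Omega> w (\<phi> k)"] \<phi> wL
    by (simp add: power2_eq_square)
  finally show ?thesis by (simp add: l2_norm_def)
qed

text \<open>The squared left side is the quadratic form of the stiffness matrix at \<open>c\<close>.
  For orthonormal modes the root on the right is the norm of the combination with coefficients
  \<open>c\<close>.\<close>

lemma inverse_estimate: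
  assumes \<phi>: "\<And>k. k < r \<Longrightarrow> \<phi> k \<in> H1 \<Omega>"
  shows "l2_norm \<Omega> (\<lambda>x. \<Sum>k<r. c k *\<^sub>R weak_gradient \<Omega> (\<phi> k) x) \<le> C_inv \<Omega> r \<phi> * sqrt (\<Sum>k<r. (c k)\<^sup>2)"
proof -
  let ?g = "\<lambda>k. weak_gradient \<Omega> (\<phi> k)" and ?G = "\<lambda>x. \<Sum>k<r. c k *\<^sub>R weak_gradient \<Omega> (\<phi> k) x"
  have g: "?g k \<in> L2 \<Omega>" if "k < r" for k
    using weak_gradient_spec(1)[OF \<phi>[OF that]] .
  have G: "?G \<in> L2 \<Omega>" by (intro L2_sum L2_scaleR g) auto
  have "l2_inner \<Omega> ?G ?G = (\<Sum>i<r. c i * l2_inner \<Omega> (?g i) ?G)"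
    by (rule l2_inner_sum_left) (auto intro: g G)
  also have "\<dots> = (\<Sum>i<r. c i * (\<Sum>j<r. c j * l2_inner \<Omega> (?g i) (?g j)))"
    by (intro sum.cong refl arg_cong2[where f = "(*)"] l2_inner_sum_right) (auto intro: g)
  also have "\<dots> = (\<Sum>i<r. \<Sum>j<r. c i * c j * l2_inner \<Omega> (?g j) (?g i))"
    unfolding sum_distrib_left mult.assoc by (intro sum.cong refl) (simp add: l2_inner_commute)
  also have "\<dots> \<le> mat_norm2 (stiffness_matrix \<Omega> r \<phi>) * (\<Sum>i<r. (c i)\<^sup>2)"
    unfolding stiffness_matrix_def
    using quadratic_form_le_mat_norm2[where S = "\<lambda>(i, j). l2_inner \<Omega> (?g j) (?g i)"] by simp
  finally show ?thesis
    unfolding l2_norm_def C_inv_def real_sqrt_mult[symmetric] by (rule real_sqrt_le_mono)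
qed

section \<open>The error equation\<close>

text \<open>Modes are finite combinations of snapshots, which lie in \<open>H10 \<Omega>\<close>.
  The inclusion admits POD functions as test functions in the weak heat equation.\<close>

lemma POD_space_subset_H10:
  assumes "open \<Omega>" and s: "\<And>j. j < M \<Longrightarrow> s j \<in> H10 \<Omega>"
    and \<phi>: "\<And>k. k < r \<Longrightarrow> \<phi> k = POD_mode M s ev v k"
  shows "k < r \<Longrightarrow> \<phi> k \<in> H10 \<Omega>" and "L2_span \<Omega> r \<phi> \<subseteq> H10 \<Omega>"
proof -
  have \<Omega>: "\<Omega> \<in> sets lebesgue" using assms(1) by auto
  show \<phi>H: "\<phi> k \<in> H10 \<Omega>" if "k < r" for k
  proof -
    have "POD_mode M s ev v k = (\<lambda>x. \<Sum>j<M. (ev k powr (- 1 / 2) * vec_index (v k) j) * s j x)"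
      by (auto simp: POD_mode_def sum_distrib_left mult.assoc)
    then show ?thesis
      using \<phi>[OF that] H10_sum[OF assms(1) s] by simp
  qed
  show "L2_span \<Omega> r \<phi> \<subseteq> H10 \<Omega>"
  proof
    fix g assume "g \<in> L2_span \<Omega> r \<phi>"
    then obtain c where g: "g \<in> L2 \<Omega>" and c: "AE x in lebesgue_on \<Omega>. g x = (\<Sum>k<r. c k * \<phi> k x)"
      by (auto simp: L2_span_def)
    have "AE x in lebesgue_on \<Omega>. (\<Sum>k<r. c k * \<phi> k x) = g x"
      using c by eventually_elim simp
    moreover have "(\<lambda>x. \<Sum>k<r. c k * \<phi> k x) \<in> H10 \<Omega>"
      by (intro H10_sum assms(1) \<phi>H)
    ultimately show "g \<in> H10 \<Omega>"
      using H10_cong_AE[OF \<Omega> _ g] by blast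
  qed
qed

lemma L2_span_diff:
  assumes "g \<in> L2_span \<Omega> r \<phi>" "h \<in> L2_span \<Omega> r \<phi>"
  shows "(\<lambda>x. g x - h x) \<in> L2_span \<Omega> r \<phi>"
proof -
  obtain c d where gh: "g \<in> L2 \<Omega>" "h \<in> L2 \<Omega>"
    and "AE x in lebesgue_on \<Omega>. g x = (\<Sum>k<r. c k * \<phi> k x)"
      "AE x in lebesgue_on \<Omega>. h x = (\<Sum>k<r. d k * \<phi> k x)"
    using assms by (auto simp: L2_span_def)
  then have "AE x in lebesgue_on \<Omega>. g x - h x = (\<Sum>k<r. (c k - d k) * \<phi> k x)"
    by (elim AE_mp) (auto simp: left_diff_distrib sum_subtractf)
  then show ?thesis
    using L2_diff[OF gh] unfolding L2_span_def by (intro CollectI conjI exI[of _ "\<lambda>k. c k - d k"])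
qed

lemma L2_orthonormal_in_span:
  assumes "L2_orthonormal \<Omega> r \<phi>" "k < r"
  shows "\<phi> k \<in> L2_span \<Omega> r \<phi>"
proof -
  have "\<phi> k x = (\<Sum>i<r. (if i = k then 1 else 0) * \<phi> i x)" for x
    using assms(2) by (simp add: if_distrib[of "\<lambda>a. a * _"] cong: if_cong)
  then show ?thesis
    using assms unfolding L2_span_def L2_orthonormal_def by (auto intro!: exI[of _ "\<lambda>i. if i = k then 1 else 0"])
qed

lemma H10_weak_gradient_diff:
  assumes "open \<Omega>" "u \<in> H10 \<Omega>" "v \<in> H10 \<Omega>"
  shows "AE x in lebesgue_on \<Omega>. weak_gradient \<Omega> (\<lambda>x. u x - v x) x = weak_gradient \<Omega> u x - weak_gradient \<Omega> v x"
  using H1_lincomb(2)[OF assms(1) H10_H1[OF assms(2)] H10_H1[OF assms(3)], of 1 "-1"] by simp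

text \<open>A norm may fail to be differentiable where it vanishes. Hence differentiability is
  claimed only at nonzero values, while the bound covers every derivative that exists, one-sided at
  \<open>0\<close> and \<open>T\<close>.\<close>

theorem mainTheorem4:
  fixes \<Omega> :: "'a::euclidean_space set"
    and T \<nu> :: real
    and f u ur Pu \<eta> \<phi>r :: "real \<Rightarrow> 'a \<Rightarrow> real"
    and N M d r :: nat
    and \<tau> :: "nat \<Rightarrow> real"
    and s \<phi> :: "nat \<Rightarrow> 'a \<Rightarrow> real"
    and ev :: "nat \<Rightarrow> real"
    and v :: "nat \<Rightarrow> real vec"
    and Xr :: "('a \<Rightarrow> real) set"
  assumes "open \<Omega>" and "connected \<Omega>" and "\<Omega> \<noteq> {}"
    and "T > 0" and "\<nu> > 0"
    and "\<forall>t\<in>{0..T}. f t \<in> L2 \<Omega>"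
    and "heat_solution_in (H10 \<Omega>) \<Omega> T \<nu> f u"
    and "\<forall>j\<le>N. \<tau> j \<in> {0..T}"
    and "M = N + 1" and "\<forall>j<M. s j = u (\<tau> j)"
    and "d = L2_dim \<Omega> (L2_span \<Omega> M s)"
    and "r \<le> d"
    and "positive_eigensystem (correlation_matrix \<Omega> M s) d ev v"
    and "\<forall>k<r. \<phi> k = POD_mode M s ev v k"
    and "is_POD_basis \<Omega> M s r \<phi>"
    and "Xr = L2_span \<Omega> r \<phi>"
    and "heat_solution_in Xr \<Omega> T \<nu> f ur"
    and "\<forall>t\<in>{0..T}. is_L2_projection \<Omega> Xr (u t) (Pu t)"
    and "\<eta> = (\<lambda>t x. u t x - Pu t x)"
    and "\<phi>r = (\<lambda>t x. ur t x - Pu t x)"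
  shows "\<forall>t\<in>{0..T}.
     (l2_norm \<Omega> (\<phi>r t) \<noteq> 0 \<longrightarrow>
        (\<lambda>t'. l2_norm \<Omega> (\<phi>r t')) differentiable (at t within {0..T})) \<and>
     (\<forall>D. ((\<lambda>t'. l2_norm \<Omega> (\<phi>r t')) has_real_derivative D) (at t within {0..T}) \<longrightarrow>
        1 / 2 * D \<le> C_inv \<Omega> r \<phi> * \<nu> * l2_norm \<Omega> (weak_gradient \<Omega> (\<eta> t)))"
proof
  fix t assume t: "t \<in> {0..T}"
  let ?I = "l2_inner \<Omega>" and ?g = "\<lambda>w. weak_gradient \<Omega> w"
  have on: "L2_orthonormal \<Omega> r \<phi>"
    using assms(15) by (simp add: is_POD_basis_def)
  have uH: "u t' \<in> H10 \<Omega>" if "t' \<in> {0..T}" for t'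
    using assms(7) that by (simp add: heat_solution_in_def)
  have sH: "s j \<in> H10 \<Omega>" if "j < M" for j
    using assms(8-10) that uH by simp
  have \<phi>H: "\<phi> k \<in> H10 \<Omega>" if "k < r" for k
    using POD_space_subset_H10(1)[OF assms(1), of M s r \<phi> ev v k] sH assms(14) that by blast
  have XrH: "Xr \<subseteq> H10 \<Omega>"
    using POD_space_subset_H10(2)[OF assms(1), of M s r \<phi> ev v] sH assms(14,16) by blast
  have \<phi>X: "\<phi> k \<in> Xr" if "k < r" for k
    using L2_orthonormal_in_span[OF on that] assms(16) by simp
  have urX: "ur t' \<in> Xr" if "t' \<in> {0..T}" for t'
    using assms(17) that by (simp add: heat_solution_in_def)
  have PuX: "Pu t' \<in> Xr" if "t' \<in> {0..T}" for t'
    using assms(18) that by (simp add: is_L2_projection_def)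
  have \<phi>rX: "\<phi>r t' \<in> Xr" if "t' \<in> {0..T}" for t'
    using L2_span_diff urX[OF that] PuX[OF that] by (simp add: assms(16,20))
  have HL: "w \<in> L2 \<Omega>" if "w \<in> H10 \<Omega>" for w
    using that by (intro H1_L2 H10_H1)
  have gL: "?g w \<in> L2 \<Omega>" if "w \<in> H10 \<Omega>" for w
    using that by (intro weak_gradient_spec H10_H1)
  note H = uH[OF t] subsetD[OF XrH urX[OF t]] subsetD[OF XrH PuX[OF t]] subsetD[OF XrH \<phi>rX[OF t]]
  have \<eta>H: "\<eta> t \<in> H10 \<Omega>"
    using H10_lincomb[OF assms(1) H(1) H(3), of 1 "-1"] by (simp add: assms(19))
  define \<alpha> where "\<alpha> k t' = ?I (\<phi>r t') (\<phi> k)" for k t'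
  \<comment> \<open>The right side of the error equation tested with \<open>\<phi> k\<close>;
    \<open>der\<close> shows that it is the derivative of \<open>\<alpha> k\<close> at
    \<open>t\<close>.\<close>
  define \<beta> where "\<beta> k = \<nu> * (?I (?g (\<eta> t)) (?g (\<phi> k)) - ?I (?g (\<phi>r t)) (?g (\<phi> k)))" for k
  define B where "B = C_inv \<Omega> r \<phi> * \<nu> * l2_norm \<Omega> (?g (\<eta> t))"
  have norm: "l2_norm \<Omega> (\<phi>r t') = sqrt (\<Sum>k<r. (\<alpha> k t')\<^sup>2)" if "t' \<in> {0..T}" for t'
    using L2_orthonormal_Parseval[OF on] \<phi>rX[OF that] by (simp add: \<alpha>_def assms(16))
  \<comment> \<open>Orthogonality of \<eta> to the modes replaces \<open>Pu\<close> by
    \<open>u\<close>, whose products with modes are differentiable by the weak equation. So the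
    projection is never differentiated in time.\<close>
  have \<alpha>_diff: "\<alpha> k t' = ?I (ur t') (\<phi> k) - ?I (u t') (\<phi> k)" if k: "k < r" and t': "t' \<in> {0..T}" for k t'
  proof -
    note L = HL[OF uH[OF t']] HL[OF subsetD[OF XrH urX[OF t']]] HL[OF subsetD[OF XrH PuX[OF t']]] HL[OF \<phi>H[OF k]]
    have "?I (\<lambda>x. u t' x - Pu t' x) (\<phi> k) = 0"
      using assms(18) t' \<phi>X[OF k] by (simp add: is_L2_projection_def)
    then have "?I (u t') (\<phi> k) = ?I (Pu t') (\<phi> k)"
      by (simp add: l2_inner_diff_left L)
    then show ?thesis
      by (simp add: \<alpha>_def assms(20) l2_inner_diff_left L)
  qed
  \<comment> \<open>The projection cancels: \<open>u - ur\<close> equals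
    \<open>\<eta> - \<phi>r\<close>. For the chosen gradients this holds almost everywhere, which is
    enough under the integral.\<close>
  have grad_diff: "?I (?g (u t)) (?g w) - ?I (?g (ur t)) (?g w) = ?I (?g (\<eta> t)) (?g w) - ?I (?g (\<phi>r t)) (?g w)"
    if w: "w \<in> H10 \<Omega>" for w
  proof -
    have "?I (?g (\<eta> t)) (?g w) = ?I (\<lambda>x. ?g (u t) x - ?g (Pu t) x) (?g w)"
      using H10_weak_gradient_diff[OF assms(1) H(1) H(3)]
      by (intro l2_inner_cong_AE) (auto intro: gL \<eta>H w L2_diff H simp: assms(19)[symmetric] fun_cong[OF assms(19), symmetric])
    moreover have "?I (?g (\<phi>r t)) (?g w) = ?I (\<lambda>x. ?g (ur t) x - ?g (Pu t) x) (?g w)"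
      using H10_weak_gradient_diff[OF assms(1) H(2) H(3)]
      by (intro l2_inner_cong_AE) (auto intro: gL w L2_diff H simp: fun_cong[OF assms(20), symmetric])
    ultimately show ?thesis
      by (simp add: l2_inner_diff_left gL H w)
  qed
  have der: "(\<alpha> k has_real_derivative \<beta> k) (at t within {0..T})" if k: "k < r" for k
  proof -
    obtain D1 where D1: "((\<lambda>s. ?I (u s) (\<phi> k)) has_real_derivative D1) (at t within {0..T})"
        "D1 + \<nu> * ?I (?g (u t)) (?g (\<phi> k)) = ?I (f t) (\<phi> k)"
      using assms(7) t \<phi>H[OF k] unfolding heat_solution_in_def by blast
    obtain D2 where D2: "((\<lambda>s. ?I (ur s) (\<phi> k)) has_real_derivative D2) (at t within {0..T})"
        "D2 + \<nu> * ?I (?g (ur t)) (?g (\<phi> k)) = ?I (f t) (\<phi> k)"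
      using assms(17) t \<phi>X[OF k] unfolding heat_solution_in_def by blast
    \<comment> \<open>The mode is admissible in both equations, and the forcing cancels.\<close>
    have "D2 - D1 = \<nu> * (?I (?g (u t)) (?g (\<phi> k)) - ?I (?g (ur t)) (?g (\<phi> k)))"
      using D1(2) D2(2) by (simp add: right_diff_distrib)
    then have "D2 - D1 = \<beta> k"
      by (simp add: \<beta>_def grad_diff[OF \<phi>H[OF k]])
    then have "((\<lambda>s. ?I (ur s) (\<phi> k) - ?I (u s) (\<phi> k)) has_real_derivative \<beta> k) (at t within {0..T})"
      using DERIV_diff[OF D2(1) D1(1)] by simp
    then show ?thesis
      unfolding has_field_derivative_def
      by (rule has_derivative_transform[OF t, rotated]) (use \<alpha>_diff[OF k] in auto)
  qed
  have g\<phi>r: "AE x in lebesgue_on \<Omega>. ?g (\<phi>r t) x = (\<Sum>k<r. \<alpha> k t *\<^sub>R ?g (\<phi> k) x)"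
  proof -
    have ae: "AE x in lebesgue_on \<Omega>. \<phi>r t x = (\<Sum>k<r. \<alpha> k t * \<phi> k x)"
      using L2_orthonormal_expansion[OF on] \<phi>rX[OF t] by (simp add: \<alpha>_def assms(16))
    have "?g (\<phi>r t) = ?g (\<lambda>x. \<Sum>k<r. \<alpha> k t * \<phi> k x)"
      using assms(1) by (intro weak_gradient_cong_AE ae HL H H10_sum \<phi>H) auto
    then show ?thesis
      using H10_weak_gradient_sum[OF assms(1), of r \<phi> "\<lambda>k. \<alpha> k t"] \<phi>H by simp
  qed
  text \<open>Testing the error equation with \<open>\<Sum>k<r. c k * \<phi> k\<close>; needed for \<open>c k = \<alpha> k t\<close>, and for \<open>c = \<beta>\<close> where
    \<open>\<phi>r t\<close> vanishes.\<close>
  let ?V = "\<lambda>c x. \<Sum>k<r. c k *\<^sub>R ?g (\<phi> k) x"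
  have VL: "?V c \<in> L2 \<Omega>" for c
    by (intro L2_sum L2_scaleR gL \<phi>H) simp
  have test: "(\<Sum>k<r. c k * \<beta> k) \<le> B * sqrt (\<Sum>k<r. (c k)\<^sup>2)" if c: "?I (?g (\<phi>r t)) (?V c) \<ge> 0" for c
  proof -
    have "(\<Sum>k<r. c k * \<beta> k) = \<nu> * ((\<Sum>k<r. c k * ?I (?g (\<eta> t)) (?g (\<phi> k))) - (\<Sum>k<r. c k * ?I (?g (\<phi>r t)) (?g (\<phi> k))))"
      by (simp add: \<beta>_def sum_distrib_left right_diff_distrib sum_subtractf mult_ac)
    also have "\<dots> = \<nu> * (?I (?g (\<eta> t)) (?V c) - ?I (?g (\<phi>r t)) (?V c))"
      by (subst (1 2) l2_inner_sum_right) (auto intro: gL \<phi>H \<eta>H H)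
    \<comment> \<open>The sign condition \<open>c\<close> discards the product with the gradient of
      \<phi>r; Cauchy-Schwarz bounds the other one.\<close>
    also have "\<dots> \<le> \<nu> * (l2_norm \<Omega> (?g (\<eta> t)) * l2_norm \<Omega> (?V c))"
      using c l2_Cauchy_Schwarz[OF gL[OF \<eta>H] VL[of c]] assms(5) by (intro mult_left_mono) auto
    also have "\<dots> \<le> \<nu> * (l2_norm \<Omega> (?g (\<eta> t)) * (C_inv \<Omega> r \<phi> * sqrt (\<Sum>k<r. (c k)\<^sup>2)))"
      using assms(5) inverse_estimate[of r \<phi> \<Omega> c] \<phi>H
      by (intro mult_left_mono) (auto simp: l2_norm_ge_0 intro: H10_H1)
    finally show ?thesis by (simp add: B_def mult_ac)
  qed
  have B0: "B \<ge> 0"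
    using assms(5) by (simp add: B_def C_inv_def mat_norm2_ge_0 l2_norm_ge_0)
  have E1: "(\<Sum>k<r. \<alpha> k t * \<beta> k) \<le> B * sqrt (\<Sum>k<r. (\<alpha> k t)\<^sup>2)"
  proof (rule test)
    \<comment> \<open>For the coordinates of \<phi>r itself the discarded term is a squared norm,
      hence nonnegative.\<close>
    have "?I (?g (\<phi>r t)) (?V (\<lambda>k. \<alpha> k t)) = ?I (?g (\<phi>r t)) (?g (\<phi>r t))"
      by (rule l2_inner_cong_AE) (use g\<phi>r in \<open>auto intro: gL H VL elim!: eventually_mono\<close>)
    then show "?I (?g (\<phi>r t)) (?V (\<lambda>k. \<alpha> k t)) \<ge> 0"
      by (simp add: l2_inner_ge_0)
  qed
  have E2: "(\<Sum>k<r. (\<beta> k)\<^sup>2) \<le> B * sqrt (\<Sum>k<r. (\<beta> k)\<^sup>2)" if "sqrt (\<Sum>k<r. (\<alpha> k t)\<^sup>2) = 0"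
  proof -
    have "\<alpha> k t = 0" if "k < r" for k
      using \<open>sqrt _ = 0\<close> that by (simp add: sum_nonneg_eq_0_iff)
    \<comment> \<open>With a zero gradient the sign condition holds with equality for any
      coefficients, so \<beta> may be used.\<close>
    then have "AE x in lebesgue_on \<Omega>. ?g (\<phi>r t) x = 0"
      using g\<phi>r by simp
    then have "?I (?g (\<phi>r t)) (?V \<beta>) = ?I (\<lambda>x. 0) (?V \<beta>)"
      by (intro l2_inner_cong_AE) (auto intro: gL H VL L2_zero)
    then have "?I (?g (\<phi>r t)) (?V \<beta>) \<ge> 0"
      by (simp add: l2_inner_def)
    from test[OF this] show ?thesis
      by (simp add: power2_eq_square)
  qed
  note main = euclidean_norm_derivative[where \<alpha> = \<alpha> and \<beta> = \<beta> and r = r, OF assms(4) t der B0 E1 E2]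
  show "(l2_norm \<Omega> (\<phi>r t) \<noteq> 0 \<longrightarrow>
        (\<lambda>t'. l2_norm \<Omega> (\<phi>r t')) differentiable (at t within {0..T})) \<and>
     (\<forall>D. ((\<lambda>t'. l2_norm \<Omega> (\<phi>r t')) has_real_derivative D) (at t within {0..T}) \<longrightarrow>
        1 / 2 * D \<le> C_inv \<Omega> r \<phi> * \<nu> * l2_norm \<Omega> (weak_gradient \<Omega> (\<eta> t)))"
  proof (intro conjI impI allI)
    assume "l2_norm \<Omega> (\<phi>r t) \<noteq> 0"
    then obtain E where "((\<lambda>y. sqrt (\<Sum>k<r. (\<alpha> k y)\<^sup>2)) has_derivative E) (at t within {0..T})"
      using main(1) norm[OF t] unfolding differentiable_def by auto
    then have "((\<lambda>t'. l2_norm \<Omega> (\<phi>r t')) has_derivative E) (at t within {0..T})"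
      by (rule has_derivative_transform[OF t, rotated]) (use norm in auto)
    then show "(\<lambda>t'. l2_norm \<Omega> (\<phi>r t')) differentiable (at t within {0..T})"
      by (auto simp: differentiable_def)
  next
    fix D assume "((\<lambda>t'. l2_norm \<Omega> (\<phi>r t')) has_real_derivative D) (at t within {0..T})"
    then have "((\<lambda>y. sqrt (\<Sum>k<r. (\<alpha> k y)\<^sup>2)) has_real_derivative D) (at t within {0..T})"
      unfolding has_field_derivative_def
      by (rule has_derivative_transform[OF t, rotated]) (use norm in auto)
    \<comment> \<open>The bound is obtained without the factor 1/2; as \<open>B\<close> is
      nonnegative, halving the derivative preserves it.\<close>
    from main(2)[OF _ _ this] have "D \<le> B" by auto
    then show "1 / 2 * D \<le> C_inv \<Omega> r \<phi> * \<nu> * l2_norm \<Omega> (weak_gradient \<Omega> (\<eta> t))"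
      using B0 unfolding B_def[symmetric] by linarith
  qed
qed

end
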